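(* Let $R=D[X;\sigma,\delta]$ be an Ore extension of a skew field $D$ (with $\sigma$ an automorphism of $D$ and $\delta$ a $\sigma$-derivation) satisfying: (1) $R$ is a free module of finite rank $r$ over its center $C$; (2) $C=K[z]$, where $K$ is a commutative subfield of the center of $D$ invariant under $\sigma$ and such that $\delta(K)=0$, and $z\in R$ is a (central) nonconstant polynomial; (3) every nonzero twosided polynomial of $R$ is, up to multiplication by a constant in $D$, of the form $X^m\alpha$ with $\alpha\in K[z]$ and $m\ge0$. Let $f\in R$ be such that $f^*\in K[z]$ is irreducible. Put $K_f=K[z]/K[z]f^*$ and $A=R/Rf^*$, and consider an idempotent $e\in A$ such that $Ae=Aa$, where $a=f+Rf^*$. Then $f$ is irreducible if and only if the (simple) $K_f$-algebra $(1-e)A(1-e)$ is a skew field.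
   Context: A $\sigma$-derivation is an additive map $\delta:D\to D$ with $\delta(ab)=\sigma(a)\delta(b)+\delta(a)b$. $R=D[X;\sigma,\delta]$ has left $D$-basis $\{X^n:n\ge0\}$ and $Xa=\sigma(a)X+\delta(a)$ for $a\in D$. A polynomial $\alpha$ is twosided if $R\alpha=\alpha R$. A bound $f^*$ of $f$ is a polynomial with $Rf^*=f^*R=\operatorname{Ann}_R(R/Rf)$ (the largest twosided ideal contained in $Rf$), determined up to left multiplication by nonzero elements of $D$; "$f^*\in K[z]$ is irreducible" means that a bound is chosen in $K[z]$ and is irreducible as a polynomial in $K[z]$. Irreducibility of $f$ is meant in $R$.
   Formalization: The parenthetical "(simple)" is not asserted, as it can fail: for D=F_{q^n}, σ Frobenius of order n≥2, δ=0, K=F_q, z=X^n, f=f*=X^n, e=0, the algebra is R/RX^n, not simple; the equivalence is proved in all cases. *)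

theory Defs
  imports "HOL-Algebra.Algebra"
begin

text \<open>
  No commutativity is assumed for the ambient rings below.  For a ring \<open>S\<close> and \<open>a \<in> carrier S\<close>
  the left ideal \<open>Sa\<close> is the library's \<open>carrier S #>\<^bsub>S\<^esub> a\<close> and the right ideal \<open>aS\<close> is
  \<open>a <#\<^bsub>S\<^esub> carrier S\<close>.
\<close>

locale skew_field = ring S for S (structure) +
  assumes one_neq_zero: "\<one> \<noteq> \<zero>"
    and Units_nonzero: "Units S = carrier S - {\<zero>}"

definition ring_center :: "('a, 'm) ring_scheme \<Rightarrow> 'a set" where
  "ring_center S = {c \<in> carrier S. \<forall>s \<in> carrier S. c \<otimes>\<^bsub>S\<^esub> s = s \<otimes>\<^bsub>S\<^esub> c}"

text \<open>
  The family \<open>(b i)\<close>, \<open>i \<in> I\<close>, is a basis of \<open>S\<close> as a left module over the subring \<open>T\<close>: every element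
  is a finite left \<open>T\<close>-linear combination of the \<open>b i\<close> in exactly one way.  Coefficient families
  are extensional (undefined outside \<open>I\<close>), so that \<open>\<exists>!\<close> does count coefficient families on \<open>I\<close>.
\<close>

definition left_basis ::
  "('a, 'm) ring_scheme \<Rightarrow> 'a set \<Rightarrow> 'i set \<Rightarrow> ('i \<Rightarrow> 'a) \<Rightarrow> bool" where
  "left_basis S T I b \<longleftrightarrow>
     b \<in> I \<rightarrow> carrier S \<and>
     (\<forall>x \<in> carrier S. \<exists>!c. c \<in> I \<rightarrow>\<^sub>E T \<and> finite {i \<in> I. c i \<noteq> \<zero>\<^bsub>S\<^esub>} \<and>
        x = (\<Oplus>\<^bsub>S\<^esub> i \<in> {i \<in> I. c i \<noteq> \<zero>\<^bsub>S\<^esub>}. c i \<otimes>\<^bsub>S\<^esub> b i))"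

text \<open>
  \<open>R = D[x; \<sigma>, \<delta>]\<close>, with the coefficient skew field \<open>D\<close> realised as a subring of \<open>R\<close>.  These
  conditions determine \<open>R\<close> up to a unique isomorphism fixing \<open>D\<close> and \<open>x\<close>.
\<close>

locale ore_extension = ring R for R (structure) +
  fixes D :: "'a set" and \<sigma> \<delta> :: "'a \<Rightarrow> 'a" and x :: 'a
  assumes D_subring: "subring D R"
    and D_skew_field: "skew_field (R\<lparr>carrier := D\<rparr>)"
    and sigma_automorphism: "\<sigma> \<in> ring_iso (R\<lparr>carrier := D\<rparr>) (R\<lparr>carrier := D\<rparr>)"
    and delta_closed: "\<delta> \<in> D \<rightarrow> D"
    and delta_add: "\<And>a b. \<lbrakk>a \<in> D; b \<in> D\<rbrakk> \<Longrightarrow> \<delta> (a \<oplus> b) = \<delta> a \<oplus> \<delta> b"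
    and delta_mult: "\<And>a b. \<lbrakk>a \<in> D; b \<in> D\<rbrakk> \<Longrightarrow> \<delta> (a \<otimes> b) = \<sigma> a \<otimes> \<delta> b \<oplus> \<delta> a \<otimes> b"
    and x_closed: "x \<in> carrier R"
    and powers_basis: "left_basis R D (UNIV :: nat set) (\<lambda>n. x [^] n)"
    and x_commutation: "\<And>a. a \<in> D \<Longrightarrow> x \<otimes> a = \<sigma> a \<otimes> x \<oplus> \<delta> a"

definition twosided :: "('a, 'm) ring_scheme \<Rightarrow> 'a \<Rightarrow> bool" where
  "twosided S g \<longleftrightarrow> g \<in> carrier S \<and> carrier S #>\<^bsub>S\<^esub> g = g <#\<^bsub>S\<^esub> carrier S"

text \<open>
  The annihilator of the left module \<open>S/Sf\<close>: \<open>r\<close> kills the class of \<open>s\<close> iff \<open>rs \<in> Sf\<close>.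
\<close>

definition annihilator_quot :: "('a, 'm) ring_scheme \<Rightarrow> 'a \<Rightarrow> 'a set" where
  "annihilator_quot S f =
     {r \<in> carrier S. \<forall>s \<in> carrier S. r \<otimes>\<^bsub>S\<^esub> s \<in> carrier S #>\<^bsub>S\<^esub> f}"

definition is_bound :: "('a, 'm) ring_scheme \<Rightarrow> 'a \<Rightarrow> 'a \<Rightarrow> bool" where
  "is_bound S f g \<longleftrightarrow> twosided S g \<and> carrier S #>\<^bsub>S\<^esub> g = annihilator_quot S f"

text \<open>
  The library's \<open>irreducible\<close> is phrased through one-sided divisibility and is meant for commutative
  monoids; here is the usual notion for a possibly noncommutative ring.
\<close>

definition nc_irreducible :: "('a, 'm) ring_scheme \<Rightarrow> 'a \<Rightarrow> bool" where
  "nc_irreducible S f \<longleftrightarrow>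
     f \<in> carrier S \<and> f \<noteq> \<zero>\<^bsub>S\<^esub> \<and> f \<notin> Units S \<and>
     (\<forall>g \<in> carrier S. \<forall>h \<in> carrier S. f = g \<otimes>\<^bsub>S\<^esub> h \<longrightarrow> g \<in> Units S \<or> h \<in> Units S)"

text \<open>
  The ring \<open>uSu\<close> for an idempotent \<open>u\<close>; its identity element is \<open>u\<close>.
\<close>

definition corner_ring :: "('a, 'm) ring_scheme \<Rightarrow> 'a \<Rightarrow> ('a, 'm) ring_scheme" where
  "corner_ring S u =
     S\<lparr>carrier := {u \<otimes>\<^bsub>S\<^esub> x \<otimes>\<^bsub>S\<^esub> u | x. x \<in> carrier S}, one := u\<rparr>"

end

theory Submission
  imports Defs
begin

text \<open>
  Since \<open>f\<^sup>* \<in> Rf\<close> and left ideals of \<open>R\<close> are principal, \<open>f\<close> is irreducible iff \<open>Rf\<close> is a maximal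
  left ideal, iff \<open>Aa = Ae\<close> is a maximal left ideal of \<open>A\<close>.  With \<open>u = 1 - e\<close> this means that the
  complement \<open>Au\<close> is a simple module, so that \<open>uAu\<close> is a skew field by Schur's lemma.  Conversely,
  if \<open>uAu\<close> is a skew field and \<open>AuA = A\<close>, then every nonzero \<open>l \<in> Au\<close> satisfies \<open>uAl \<noteq> 0\<close> and
  hence generates \<open>Au\<close>.

  The algebra \<open>A\<close> itself need not be simple (\<open>R = D[x; \<sigma>]\<close>, \<open>f\<^sup>* = x\<^sup>n\<close>), so \<open>AuA = A\<close> has to use that
  \<open>AuA\<close> is an idempotent ideal.  Its preimage in \<open>R\<close> is \<open>RN\<close> with \<open>N\<close> twosided and \<open>f\<^sup>* = hN\<close>;
  idempotency gives \<open>RN = (RN + Rh)N\<close>, that is \<open>R = RN + Rh\<close>.  By hypothesis (3) the twosided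
  polynomials \<open>N\<close> and \<open>h\<close> are of the form \<open>d x\<^sup>m \<alpha>\<close>, and they cannot both lie in \<open>Rx\<close>; so one of them
  is central up to a constant, and irreducibility of \<open>f\<^sup>*\<close> makes \<open>N\<close> or \<open>h\<close> a unit.
\<close>

section \<open>Maximal left ideals and corner rings\<close>

lemma mem_left_ideal_iff:
  "y \<in> carrier S #>\<^bsub>S\<^esub> g \<longleftrightarrow> (\<exists>s\<in>carrier S. y = s \<otimes>\<^bsub>S\<^esub> g)"
  by (auto simp: r_coset_def)

lemma mem_right_ideal_iff:
  "y \<in> g <#\<^bsub>S\<^esub> carrier S \<longleftrightarrow> (\<exists>s\<in>carrier S. y = g \<otimes>\<^bsub>S\<^esub> s)"
  by (auto simp: l_coset_def)

text \<open>
  This amounts to maximality only for \<open>L\<close> a left ideal, which is not part of the definition.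
\<close>

definition left_maximal :: "('a, 'm) ring_scheme \<Rightarrow> 'a set \<Rightarrow> bool" where
  "left_maximal S L \<longleftrightarrow> \<one>\<^bsub>S\<^esub> \<notin> L \<and>
     (\<forall>y \<in> carrier S - L. \<exists>g \<in> L. \<exists>t \<in> carrier S. \<one>\<^bsub>S\<^esub> = g \<oplus>\<^bsub>S\<^esub> t \<otimes>\<^bsub>S\<^esub> y)"

context ring
begin

section \<open>Corner rings of idempotents and Schur's lemma\<close>

lemma corner_carrier:
  assumes "u \<in> carrier R" "u \<otimes> u = u"
  shows "carrier (corner_ring R u) = {w \<in> carrier R. u \<otimes> w = w \<and> w \<otimes> u = w}"
proof -
  have "u \<otimes> (u \<otimes> y \<otimes> u) = u \<otimes> y \<otimes> u" if "y \<in> carrier R" for y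
    using that assms by (simp add: m_assoc[symmetric])
  moreover have "u \<otimes> y \<otimes> u \<otimes> u = u \<otimes> y \<otimes> u" if "y \<in> carrier R" for y
    using that assms by (simp add: m_assoc)
  moreover have "w \<in> {u \<otimes> y \<otimes> u |y. y \<in> carrier R}"
    if "w \<in> carrier R" "u \<otimes> w = w" "w \<otimes> u = w" for w
    using that by (intro CollectI exI[of _ w]) simp
  ultimately show ?thesis
    using assms unfolding corner_ring_def by auto
qed

lemma corner_ring_is_ring:
  assumes "u \<in> carrier R" "u \<otimes> u = u"
  shows "ring (corner_ring R u)"
proof -
  have ops: "(\<otimes>\<^bsub>corner_ring R u\<^esub>) = (\<otimes>)" "(\<oplus>\<^bsub>corner_ring R u\<^esub>) = (\<oplus>)"
    "\<one>\<^bsub>corner_ring R u\<^esub> = u" "\<zero>\<^bsub>corner_ring R u\<^esub> = \<zero>"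
    by (simp_all add: corner_ring_def)
  note c = corner_carrier[OF assms]
  show ?thesis
  proof (rule ringI)
    show "abelian_group (corner_ring R u)"
    proof (rule abelian_groupI, unfold ops c)
      fix w assume w: "w \<in> {w \<in> carrier R. u \<otimes> w = w \<and> w \<otimes> u = w}"
      show "\<exists>y\<in>{w \<in> carrier R. u \<otimes> w = w \<and> w \<otimes> u = w}. y \<oplus> w = \<zero>"
        using w assms by (intro bexI[of _ "\<ominus> w"]) (auto simp: l_neg l_minus r_minus)
    qed (use assms in \<open>auto simp: r_distr l_distr a_ac\<close>)
    show "Group.monoid (corner_ring R u)"
      by (rule monoidI, unfold ops c) (use assms in \<open>auto simp: m_assoc, simp add: m_assoc[symmetric]\<close>)
  qed (unfold ops c, auto simp: l_distr r_distr)
qed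

text \<open>It suffices to look for left inverses, and in the whole ring:
  \<open>u \<otimes> v \<otimes> u\<close> moves such a \<open>v\<close> into the corner, and once
  every nonzero element has a left inverse there, these inverses are twosided.\<close>

lemma skew_field_corner_iff:
  assumes u: "u \<in> carrier R" "u \<otimes> u = u"
  shows "skew_field (corner_ring R u) \<longleftrightarrow> u \<noteq> \<zero> \<and>
    (\<forall>w \<in> carrier R. u \<otimes> w = w \<and> w \<otimes> u = w \<and> w \<noteq> \<zero> \<longrightarrow> (\<exists>v \<in> carrier R. v \<otimes> w = u))"
proof -
  let ?U = "corner_ring R u"
  note c = corner_carrier[OF u]
  have ops: "(\<otimes>\<^bsub>?U\<^esub>) = (\<otimes>)" "\<one>\<^bsub>?U\<^esub> = u" "\<zero>\<^bsub>?U\<^esub> = \<zero>"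
    by (simp_all add: corner_ring_def)
  interpret U: ring ?U by (rule corner_ring_is_ring[OF u])
  show ?thesis
  proof
    assume "skew_field ?U"
    then interpret U: skew_field ?U .
    have "\<exists>v \<in> carrier R. v \<otimes> w = u"
      if "w \<in> carrier R" "u \<otimes> w = w" "w \<otimes> u = w" "w \<noteq> \<zero>" for w
    proof -
      have "w \<in> Units ?U" using that U.Units_nonzero by (simp add: c ops)
      then show ?thesis unfolding Units_def by (auto simp: c ops)
    qed
    then show "u \<noteq> \<zero> \<and> (\<forall>w \<in> carrier R. u \<otimes> w = w \<and> w \<otimes> u = w \<and> w \<noteq> \<zero> \<longrightarrow>
      (\<exists>v \<in> carrier R. v \<otimes> w = u))"
      using U.one_neq_zero by (auto simp: ops)
  next
    assume asm: "u \<noteq> \<zero> \<and> (\<forall>w \<in> carrier R. u \<otimes> w = w \<and> w \<otimes> u = w \<and> w \<noteq> \<zero> \<longrightarrow>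
      (\<exists>v \<in> carrier R. v \<otimes> w = u))"
    \<comment> \<open>The left inverse is recorded as nonzero so that the claim applies to it again,
      which makes it twosided.\<close>
    have linv: "\<exists>v \<in> carrier ?U. v \<noteq> \<zero> \<and> v \<otimes> w = u" if w: "w \<in> carrier ?U" "w \<noteq> \<zero>" for w
    proof -
      obtain v where v: "v \<in> carrier R" "v \<otimes> w = u"
        using asm w by (auto simp: c)
      have uw: "w \<in> carrier R" "u \<otimes> w = w" using w by (auto simp: c)
      have "u \<otimes> v \<otimes> u \<otimes> w = u"
        using v u uw by (simp add: m_assoc)
      moreover have "u \<otimes> v \<otimes> u \<in> carrier ?U"
        using v by (auto simp: corner_ring_def)
      moreover have "u \<otimes> v \<otimes> u \<noteq> \<zero>"
        using \<open>u \<otimes> v \<otimes> u \<otimes> w = u\<close> asm uw by (metis l_null)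
      ultimately show ?thesis by blast
    qed
    have "w \<in> Units ?U" if w: "w \<in> carrier ?U" "w \<noteq> \<zero>" for w
    proof -
      obtain v where v: "v \<in> carrier ?U" "v \<noteq> \<zero>" "v \<otimes> w = u" using linv[OF w] by blast
      obtain v' where v': "v' \<in> carrier ?U" "v' \<otimes> v = u" using linv[OF v(1,2)] by blast
      have "w = v'"
        using U.inv_unique[of v' v w] v v' w by (simp add: ops)
      then show ?thesis using v v' w unfolding Units_def by (auto simp: ops)
    qed
    moreover have "\<zero> \<notin> Units ?U"
      using asm unfolding Units_def by (auto simp: c ops)
    ultimately have "Units ?U = carrier ?U - {\<zero>}"
      unfolding Units_def by (auto simp: ops)
    then show "skew_field ?U"
      using asm by (unfold_locales) (auto simp: ops)
  qed
qed

lemma complement_idempotent: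
  assumes "e \<in> carrier R" "e \<otimes> e = e" "u = \<one> \<ominus> e"
  shows "u \<in> carrier R" "u \<otimes> u = u" "e \<otimes> u = \<zero>" "u \<otimes> e = \<zero>" "e \<oplus> u = \<one>"
proof -
  show u: "u \<in> carrier R" using assms by simp
  show 1: "e \<otimes> u = \<zero>" "u \<otimes> e = \<zero>"
    using assms by (simp_all add: minus_eq r_distr l_distr l_minus r_minus r_neg)
  have "u \<otimes> u = \<one> \<otimes> u \<ominus> e \<otimes> u"
    using assms by (simp add: minus_eq l_distr l_minus)
  then show "u \<otimes> u = u" using 1 u by (simp add: minus_eq)
  show "e \<oplus> u = \<one>"
    using assms a_lcomm[of e \<one> "\<ominus> e"] by (simp add: minus_eq r_neg)
qed

text \<open>Schur's lemma in terms of elements: a nonzero \<open>w\<close> of the corner is not in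
  \<open>Re\<close>, because \<open>w = wu\<close> while right multiplication by \<open>u\<close>
  kills \<open>Re\<close>. Maximality gives \<open>1 = se + tw\<close>, and right multiplication by
  \<open>u\<close> turns this into \<open>u = tw\<close>.\<close>

lemma skew_field_corner_if_left_maximal:
  assumes e: "e \<in> carrier R" "e \<otimes> e = e" and ud: "u = \<one> \<ominus> e"
    and max: "left_maximal R (carrier R #> e)"
  shows "skew_field (corner_ring R u)"
proof -
  note u = complement_idempotent[OF e ud]
  have "u \<noteq> \<zero>"
    using max u(5) e unfolding left_maximal_def mem_left_ideal_iff
    by (metis l_one one_closed r_zero)
  moreover have "\<exists>v \<in> carrier R. v \<otimes> w = u"
    if w: "w \<in> carrier R" "u \<otimes> w = w" "w \<otimes> u = w" "w \<noteq> \<zero>" for w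
  proof -
    have "w \<notin> carrier R #> e"
    proof
      assume "w \<in> carrier R #> e"
      then obtain s where "s \<in> carrier R" "w = s \<otimes> e" by (auto simp: mem_left_ideal_iff)
      then have "w \<otimes> u = \<zero>" using u e by (simp add: m_assoc)
      then show False using w by simp
    qed
    then obtain s t where st: "s \<in> carrier R" "t \<in> carrier R" "\<one> = s \<otimes> e \<oplus> t \<otimes> w"
      using max w unfolding left_maximal_def by (metis DiffI mem_left_ideal_iff)
    have "u = (s \<otimes> e \<oplus> t \<otimes> w) \<otimes> u" using st(3)[symmetric] u(1) by simp
    also have "\<dots> = t \<otimes> w" using st u e w by (simp add: l_distr m_assoc)
    finally show ?thesis using st by auto
  qed
  ultimately show ?thesis using skew_field_corner_iff u by blast
qed

text \<open>The assumption \<open>full\<close> ensures that no nonzero \<open>l\<close> in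
  \<open>Ru\<close> satisfies \<open>uRl = 0\<close>: the annihilator of \<open>Rl\<close> is a
  twosided ideal without \<open>1\<close>, hence without \<open>u\<close>. Some \<open>url\<close>
  is then a nonzero element of the corner, and its inverse recovers \<open>u\<close> from
  \<open>l\<close>.\<close>

lemma left_maximal_if_skew_field_corner:
  assumes e: "e \<in> carrier R" "e \<otimes> e = e" and ud: "u = \<one> \<ominus> e"
    and corner: "skew_field (corner_ring R u)"
    and full: "\<And>I. ideal I R \<Longrightarrow> u \<in> I \<Longrightarrow> \<one> \<in> I"
  shows "left_maximal R (carrier R #> e)"
  unfolding left_maximal_def
proof (intro conjI ballI)
  note u = complement_idempotent[OF e ud]
  have unz: "u \<noteq> \<zero>"
    and inv: "\<And>w. w \<in> carrier R \<Longrightarrow> u \<otimes> w = w \<Longrightarrow> w \<otimes> u = w \<Longrightarrow> w \<noteq> \<zero> \<Longrightarrow>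
      \<exists>v \<in> carrier R. v \<otimes> w = u"
    using corner skew_field_corner_iff[OF u(1,2)] by auto
  show "\<one> \<notin> carrier R #> e"
  proof
    assume "\<one> \<in> carrier R #> e"
    then obtain s where s: "s \<in> carrier R" "\<one> = s \<otimes> e" by (auto simp: mem_left_ideal_iff)
    have "u = s \<otimes> e \<otimes> u" using s(2)[symmetric] u(1) by simp
    then show False using s u e unz by (simp add: m_assoc)
  qed
  fix y assume "y \<in> carrier R - (carrier R #> e)"
  then have y: "y \<in> carrier R" "y \<notin> carrier R #> e" by auto
  \<comment> \<open>Modulo \<open>Re\<close> only the component \<open>yu\<close> of
    \<open>y\<close> matters; it is nonzero because \<open>y\<close> is not in
    \<open>Re\<close>.\<close>
  define l where "l = y \<otimes> u"
  have l: "l \<in> carrier R" "l \<otimes> u = l" using y u by (simp_all add: l_def m_assoc)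
  have y_eq: "y = y \<otimes> e \<oplus> l"
    using y u e by (simp add: l_def r_distr[symmetric])
  have "l \<noteq> \<zero>"
    using y y_eq e by (auto simp: mem_left_ideal_iff)
  \<comment> \<open>The annihilator of the left module \<open>Rl\<close>.\<close>
  define T where "T = {s \<in> carrier R. \<forall>r \<in> carrier R. s \<otimes> r \<otimes> l = \<zero>}"
  have "subgroup T (add_monoid R)"
    using l by (intro add.subgroupI)
      (auto simp: T_def l_distr l_minus)
  moreover have "a \<otimes> b \<in> T" if "a \<in> T" "b \<in> carrier R" for a b
  proof -
    have "a \<otimes> b \<otimes> r \<otimes> l = a \<otimes> (b \<otimes> r) \<otimes> l" if "r \<in> carrier R" for r
      using that \<open>a \<in> T\<close> \<open>b \<in> carrier R\<close> by (simp add: T_def m_assoc)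
    then show ?thesis using that by (simp add: T_def)
  qed
  ultimately have "ideal T R"
    using l by (intro idealI ring_axioms) (auto simp: T_def m_assoc)
  moreover have "\<one> \<notin> T"
    using l \<open>l \<noteq> \<zero>\<close> by (auto simp: T_def intro!: bexI[of _ \<one>])
  ultimately have "u \<notin> T" using full by blast
  then obtain r where r: "r \<in> carrier R" "u \<otimes> r \<otimes> l \<noteq> \<zero>" using u by (auto simp: T_def)
  moreover have "u \<otimes> (u \<otimes> r \<otimes> l) = u \<otimes> r \<otimes> l"
    using r u l by (simp flip: m_assoc)
  moreover have "u \<otimes> r \<otimes> l \<otimes> u = u \<otimes> r \<otimes> l"
    using r u l by (simp add: m_assoc)
  ultimately obtain v where v: "v \<in> carrier R" "v \<otimes> (u \<otimes> r \<otimes> l) = u"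
    using inv[of "u \<otimes> r \<otimes> l"] u l by auto
  define t where "t = v \<otimes> u \<otimes> r"
  have t: "t \<in> carrier R" "t \<otimes> l = u" using v u r l by (simp_all add: t_def m_assoc)
  \<comment> \<open>As \<open>t\<close> carries \<open>l\<close> to \<open>u\<close>, the product
    \<open>ty\<close> is \<open>u\<close> up to a multiple of \<open>e\<close>, which is then moved
    into the summand from \<open>Re\<close>.\<close>
  have ty: "t \<otimes> y = t \<otimes> y \<otimes> e \<oplus> u"
    using y_eq t l y e by (metis m_assoc m_closed r_distr)
  have "(e \<ominus> t \<otimes> y \<otimes> e) \<oplus> t \<otimes> y = e \<oplus> u"
    using t y e u by (subst (2) ty) (simp add: minus_eq a_assoc r_neg1 r_neg2)
  then have "\<one> = (\<one> \<ominus> t \<otimes> y) \<otimes> e \<oplus> t \<otimes> y"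
    using t y e u by (simp add: minus_eq l_distr l_minus)
  then show "\<exists>g\<in>carrier R #> e. \<exists>t\<in>carrier R. \<one> = g \<oplus> t \<otimes> y"
    using t y by (intro bexI[of _ "(\<one> \<ominus> t \<otimes> y) \<otimes> e"] bexI[of _ t]) (auto simp: mem_left_ideal_iff)
qed

end

section \<open>Left ideals modulo a twosided ideal\<close>

context ring
begin

lemma ring_center_iff:
  "c \<in> ring_center R \<longleftrightarrow> c \<in> carrier R \<and> (\<forall>s \<in> carrier R. c \<otimes> s = s \<otimes> c)"
  by (auto simp: ring_center_def)

lemma left_ideal_add_subgroup:
  assumes "g \<in> carrier R"
  shows "subgroup (carrier R #> g) (add_monoid R)"
proof (rule add.subgroupI)
  fix a assume "a \<in> carrier R #> g"
  then obtain s where *: "s \<in> carrier R" "a = s \<otimes> g" by (auto simp: mem_left_ideal_iff)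
  then show "\<ominus> a \<in> carrier R #> g"
    using assms by (auto simp: mem_left_ideal_iff l_minus intro!: bexI[of _ "\<ominus> s"])
  fix b assume "b \<in> carrier R #> g"
  then obtain t where "t \<in> carrier R" "b = t \<otimes> g" by (auto simp: mem_left_ideal_iff)
  with * show "a \<oplus> b \<in> carrier R #> g"
    using assms by (auto simp: mem_left_ideal_iff l_distr intro!: bexI[of _ "s \<oplus> t"])
qed (use assms in \<open>auto simp: r_coset_def\<close>)

lemma ideal_if_twosided:
  assumes "twosided R g"
  shows "ideal (carrier R #> g) R"
proof (rule idealI[OF ring_axioms])
  have g: "g \<in> carrier R" "carrier R #> g = g <# carrier R"
    using assms by (auto simp: twosided_def)
  show "subgroup (carrier R #> g) (add_monoid R)" using g left_ideal_add_subgroup by blast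
  fix a y assume *: "a \<in> carrier R #> g" "y \<in> carrier R"
  obtain s where "s \<in> carrier R" "a = s \<otimes> g" using *(1) by (auto simp: mem_left_ideal_iff)
  then show "y \<otimes> a \<in> carrier R #> g"
    using g(1) *(2) by (auto simp: mem_left_ideal_iff m_assoc intro!: bexI[of _ "y \<otimes> s"])
  obtain t where "t \<in> carrier R" "a = g \<otimes> t" using *(1) unfolding g(2) by (auto simp: mem_right_ideal_iff)
  then show "a \<otimes> y \<in> carrier R #> g"
    unfolding g(2) using g(1) *(2) by (auto simp: mem_right_ideal_iff m_assoc)
qed

lemma twosided_if_central:
  assumes "c \<in> ring_center R"
  shows "twosided R c"
  using assms by (auto simp: twosided_def ring_center_iff set_eq_iff mem_left_ideal_iff mem_right_ideal_iff)

text \<open>Correspondence of left ideals: since \<open>L\<close> contains \<open>I\<close>,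
  membership in \<open>L\<close> can be tested on cosets, and relations \<open>1 = g + ty\<close>
  can be lifted.\<close>

lemma left_maximal_Quot_iff:
  assumes I: "ideal I R" and L: "subgroup L (add_monoid R)" and le: "I \<subseteq> L" and L': "L' = (+>) I ` L"
  shows "left_maximal (R Quot I) L' \<longleftrightarrow> left_maximal R L"
proof -
  interpret I: ideal I R by (rule I)
  interpret L: additive_subgroup L R using L by (rule additive_subgroup.intro)
  have carr: "carrier (R Quot I) = (+>) I ` carrier R"
    unfolding FactRing_def A_RCOSETS_def' by auto
  interpret pi: ring_hom_ring R "R Quot I" "(+>) I" by (rule I.rcos_ring_hom_ring)
  have eq: "I +> y = I +> z \<longleftrightarrow> y \<ominus> z \<in> I" if "y \<in> carrier R" "z \<in> carrier R" for y z
    using quotient_eq_iff_same_a_r_cos[OF I that] by auto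
  have mem: "I +> y \<in> L' \<longleftrightarrow> y \<in> L" if y: "y \<in> carrier R" for y
  proof
    assume "I +> y \<in> L'"
    then obtain g where g: "g \<in> L" "I +> y = I +> g" unfolding L' by auto
    then have "y \<ominus> g \<in> L" using eq y le by auto
    then have "(y \<ominus> g) \<oplus> g \<in> L" using g by auto
    then show "y \<in> L" using y g by (simp add: minus_eq a_assoc l_neg)
  qed (auto simp: L')
  \<comment> \<open>A relation modulo \<open>I\<close> has an error term in
    \<open>I \<subseteq> L\<close>; adding it to \<open>g\<close> makes the relation exact.\<close>
  have one: "(\<exists>t \<in> carrier R. I +> \<one> = I +> (g \<oplus> t \<otimes> y)) \<longrightarrow>
      (\<exists>g \<in> L. \<exists>t \<in> carrier R. \<one> = g \<oplus> t \<otimes> y)" if "g \<in> L" "y \<in> carrier R" for g y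
  proof
    assume "\<exists>t \<in> carrier R. I +> \<one> = I +> (g \<oplus> t \<otimes> y)"
    then obtain t where t: "t \<in> carrier R" "I +> \<one> = I +> (g \<oplus> t \<otimes> y)" by blast
    moreover have "g \<oplus> t \<otimes> y \<in> carrier R" using t(1) that by simp
    ultimately have "\<one> \<ominus> (g \<oplus> t \<otimes> y) \<in> L" using eq[OF one_closed] le by blast
    then have "(\<one> \<ominus> (g \<oplus> t \<otimes> y)) \<oplus> g \<in> L" using that by auto
    moreover have "\<one> = ((\<one> \<ominus> (g \<oplus> t \<otimes> y)) \<oplus> g) \<oplus> t \<otimes> y"
      using t(1) that by (simp add: minus_eq a_assoc l_neg)
    ultimately show "\<exists>g \<in> L. \<exists>t \<in> carrier R. \<one> = g \<oplus> t \<otimes> y" using t by blast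
  qed
  show ?thesis
  proof
    assume max: "left_maximal (R Quot I) L'"
    show "left_maximal R L"
      unfolding left_maximal_def
    proof (intro conjI ballI)
      show "\<one> \<notin> L" using max mem[of \<one>] by (simp add: left_maximal_def)
      fix y assume y: "y \<in> carrier R - L"
      then have "I +> y \<in> carrier (R Quot I) - L'" using mem by auto
      then obtain G T where "G \<in> L'" "T \<in> carrier (R Quot I)"
        "\<one>\<^bsub>R Quot I\<^esub> = G \<oplus>\<^bsub>R Quot I\<^esub> T \<otimes>\<^bsub>R Quot I\<^esub> (I +> y)"
        using max unfolding left_maximal_def by blast
      moreover from this obtain g t where "g \<in> L" "G = I +> g" "t \<in> carrier R" "T = I +> t"
        unfolding L' carr by auto
      ultimately have "I +> \<one> = I +> (g \<oplus> t \<otimes> y)" using y by simp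
      then show "\<exists>g \<in> L. \<exists>t \<in> carrier R. \<one> = g \<oplus> t \<otimes> y"
        using one[of g y] y \<open>g \<in> L\<close> \<open>t \<in> carrier R\<close> by blast
    qed
  next
    assume max: "left_maximal R L"
    show "left_maximal (R Quot I) L'"
      unfolding left_maximal_def
    proof (intro conjI ballI)
      show "\<one>\<^bsub>R Quot I\<^esub> \<notin> L'" using max mem[of \<one>] by (simp add: left_maximal_def)
      fix Y assume Y: "Y \<in> carrier (R Quot I) - L'"
      then obtain y where y: "y \<in> carrier R" "Y = I +> y" unfolding carr by auto
      then have "y \<in> carrier R - L" using Y mem by auto
      then obtain g t where gt: "g \<in> L" "t \<in> carrier R" "\<one> = g \<oplus> t \<otimes> y"
        using max unfolding left_maximal_def by blast
      then have "I +> \<one> = I +> (g \<oplus> t \<otimes> y)" by simp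
      then have "\<one>\<^bsub>R Quot I\<^esub> = (I +> g) \<oplus>\<^bsub>R Quot I\<^esub> (I +> t) \<otimes>\<^bsub>R Quot I\<^esub> Y"
        using y gt(1,2) by simp
      then show "\<exists>G \<in> L'. \<exists>T \<in> carrier (R Quot I). \<one>\<^bsub>R Quot I\<^esub> = G \<oplus>\<^bsub>R Quot I\<^esub> T \<otimes>\<^bsub>R Quot I\<^esub> Y"
        using gt unfolding L' carr by blast
    qed
  qed
qed

end

section \<open>Degree and division in Ore extensions\<close>

context ore_extension
begin

section \<open>Coefficients and the filtration by degree\<close>

lemmas D_mem_carrier = subsetD[OF subringE(1)[OF D_subring]]
lemmas D_zero = subringE(2)[OF D_subring]
lemmas D_one = subringE(3)[OF D_subring]
lemmas D_neg = subringE(5)[OF D_subring]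
lemmas D_mult = subringE(6)[OF D_subring]
lemmas D_add = subringE(7)[OF D_subring]

lemma D_inverse:
  assumes "a \<in> D" "a \<noteq> \<zero>"
  shows "\<exists>b \<in> D. a \<otimes> b = \<one> \<and> b \<otimes> a = \<one>"
proof -
  interpret S: skew_field "R\<lparr>carrier := D\<rparr>" by (rule D_skew_field)
  have "a \<in> Units (R\<lparr>carrier := D\<rparr>)" using assms S.Units_nonzero by simp
  then show ?thesis unfolding Units_def by auto
qed

lemma sigma_closed: "a \<in> D \<Longrightarrow> \<sigma> a \<in> D"
  and sigma_zero: "\<sigma> \<zero> = \<zero>"
  and sigma_inj: "inj_on \<sigma> D"
  and sigma_surj: "\<sigma> ` D = D"
proof -
  let ?D = "R\<lparr>carrier := D\<rparr>"
  have hom: "\<sigma> \<in> ring_hom ?D ?D" and bij: "bij_betw \<sigma> D D"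
    using sigma_automorphism by (simp_all add: ring_iso_def)
  have D: "ring ?D" using D_skew_field by (rule skew_field.axioms)
  show "a \<in> D \<Longrightarrow> \<sigma> a \<in> D" using ring_hom_closed[OF hom, of a] by simp
  show "\<sigma> \<zero> = \<zero>" using ring_hom_zero[OF hom D D] by simp
  show "inj_on \<sigma> D" "\<sigma> ` D = D" using bij by (auto simp: bij_betw_def)
qed

lemma sigma_pow_closed: "a \<in> D \<Longrightarrow> (\<sigma> ^^ n) a \<in> D"
  by (induction n) (auto simp: sigma_closed)

lemma sigma_pow_zero: "(\<sigma> ^^ n) \<zero> = \<zero>"
  by (induction n) (auto simp: sigma_zero)

lemma sigma_pow_nonzero: "a \<in> D \<Longrightarrow> a \<noteq> \<zero> \<Longrightarrow> (\<sigma> ^^ n) a \<noteq> \<zero>"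
proof (induction n)
  case (Suc n)
  then show ?case
    using inj_onD[OF sigma_inj, of "(\<sigma> ^^ n) a" \<zero>] by (auto simp: sigma_zero D_zero sigma_pow_closed)
qed simp

lemma sigma_pow_surj: "b \<in> D \<Longrightarrow> \<exists>a \<in> D. (\<sigma> ^^ n) a = b"
proof (induction n arbitrary: b)
  case (Suc n)
  then obtain c where "c \<in> D" "b = \<sigma> c" using sigma_surj by (metis imageE)
  then show ?case using Suc.IH[of c] by auto
qed simp

text \<open>The polynomials of degree less than \<open>n\<close>. The strict bound gives the zero
  polynomial a place at \<open>n = 0\<close>, and splitting off the top term provides the induction
  for the degree arguments.\<close>

primrec deg_below :: "nat \<Rightarrow> 'a set" where
  "deg_below 0 = {\<zero>}"
| "deg_below (Suc n) = {a \<otimes> x [^] n \<oplus> g | a g. a \<in> D \<and> g \<in> deg_below n}"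

lemma deg_below_carrier: "g \<in> deg_below n \<Longrightarrow> g \<in> carrier R"
  by (induction n arbitrary: g) (auto simp: D_mem_carrier x_closed)

lemma deg_below_SucI: "a \<in> D \<Longrightarrow> g \<in> deg_below n \<Longrightarrow> a \<otimes> x [^] n \<oplus> g \<in> deg_below (Suc n)"
  by auto

lemma deg_below_zero: "\<zero> \<in> deg_below n"
proof (induction n)
  case (Suc n)
  then show ?case
    by (auto simp: x_closed D_zero intro!: exI[of _ \<zero>])
qed simp

lemma deg_below_add: "g \<in> deg_below n \<Longrightarrow> h \<in> deg_below n \<Longrightarrow> g \<oplus> h \<in> deg_below n"
proof (induction n arbitrary: g h)
  case (Suc n)
  then obtain a b g' h' where *: "a \<in> D" "b \<in> D" "g' \<in> deg_below n" "h' \<in> deg_below n"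
    "g = a \<otimes> x [^] n \<oplus> g'" "h = b \<otimes> x [^] n \<oplus> h'" by auto
  then have "g \<oplus> h = (a \<oplus> b) \<otimes> x [^] n \<oplus> (g' \<oplus> h')"
    by (simp add: D_mem_carrier x_closed deg_below_carrier l_distr a_ac)
  then show ?case using deg_below_SucI[of "a \<oplus> b" "g' \<oplus> h'" n] * Suc.IH by (simp add: D_add)
qed simp

lemma deg_below_smult: "d \<in> D \<Longrightarrow> g \<in> deg_below n \<Longrightarrow> d \<otimes> g \<in> deg_below n"
proof (induction n arbitrary: g)
  case (Suc n)
  then obtain a g' where *: "a \<in> D" "g' \<in> deg_below n" "g = a \<otimes> x [^] n \<oplus> g'" by auto
  then have "d \<otimes> g = (d \<otimes> a) \<otimes> x [^] n \<oplus> d \<otimes> g'"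
    using Suc.prems by (simp add: D_mem_carrier x_closed deg_below_carrier r_distr m_assoc)
  then show ?case using deg_below_SucI[of "d \<otimes> a" "d \<otimes> g'" n] * Suc by (simp add: D_mult)
qed (simp add: D_mem_carrier)

lemma deg_below_neg: "g \<in> deg_below n \<Longrightarrow> \<ominus> g \<in> deg_below n"
  using deg_below_smult[of "\<ominus> \<one>" g n] by (simp add: D_neg D_one deg_below_carrier l_minus)

lemma deg_below_diff: "g \<in> deg_below n \<Longrightarrow> h \<in> deg_below n \<Longrightarrow> g \<ominus> h \<in> deg_below n"
  by (simp add: minus_eq deg_below_add deg_below_neg)

lemma deg_below_lift: "g \<in> deg_below n \<Longrightarrow> g \<in> deg_below (Suc n)"
  using deg_below_SucI[of \<zero> g n] by (simp add: D_zero x_closed deg_below_carrier)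

lemma deg_below_mono: "g \<in> deg_below n \<Longrightarrow> n \<le> m \<Longrightarrow> g \<in> deg_below m"
  by (induction m) (auto simp: le_Suc_eq simp del: deg_below.simps intro: deg_below_lift)

lemma monom_deg_below: "a \<in> D \<Longrightarrow> i < n \<Longrightarrow> a \<otimes> x [^] i \<in> deg_below n"
proof -
  assume *: "a \<in> D" "i < n"
  have "a \<otimes> x [^] i \<in> deg_below (Suc i)"
    using deg_below_SucI[of a \<zero> i] * by (simp add: deg_below_zero D_mem_carrier x_closed)
  then show ?thesis using * deg_below_mono Suc_leI by blast
qed

lemma x_pow_comm: "x \<otimes> x [^] (n::nat) = x [^] n \<otimes> x"
  using nat_pow_Suc2[of x n] x_closed by simp

text \<open>Moving \<open>x\<close> past the top coefficient \<open>a\<close> makes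
  \<open>\<sigma> a\<close> the new top coefficient; the term with \<open>\<delta> a\<close> keeps
  the old exponent and falls into the lower part.\<close>

lemma x_mult_deg_below: "g \<in> deg_below n \<Longrightarrow> x \<otimes> g \<in> deg_below (Suc n)"
proof (induction n arbitrary: g)
  case 0
  then show ?case by (auto simp: x_closed deg_below_zero simp del: deg_below.simps(2))
next
  case (Suc n)
  then obtain a g' where *: "a \<in> D" "g' \<in> deg_below n" "g = a \<otimes> x [^] n \<oplus> g'" by auto
  note [simp] = D_mem_carrier x_closed sigma_closed
  have da: "\<delta> a \<in> D" using * delta_closed by auto
  have "x \<otimes> g = (x \<otimes> a) \<otimes> x [^] n \<oplus> x \<otimes> g'"
    using * by (simp add: deg_below_carrier r_distr m_assoc)
  also have "\<dots> = \<sigma> a \<otimes> x [^] Suc n \<oplus> (\<delta> a \<otimes> x [^] n \<oplus> x \<otimes> g')"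
    using * da by (simp add: x_commutation l_distr m_assoc deg_below_carrier a_assoc x_pow_comm)
  finally have 1: "x \<otimes> g = \<sigma> a \<otimes> x [^] Suc n \<oplus> (\<delta> a \<otimes> x [^] n \<oplus> x \<otimes> g')" .
  have "\<delta> a \<otimes> x [^] n \<oplus> x \<otimes> g' \<in> deg_below (Suc n)"
    using da *(2) by (intro deg_below_add Suc.IH monom_deg_below) auto
  moreover have "\<sigma> a \<in> D" using * by simp
  ultimately show ?case
    using 1 unfolding deg_below.simps(2)[of "Suc n"] by blast
qed

lemma xpow_mult_deg_below: "g \<in> deg_below n \<Longrightarrow> x [^] (k::nat) \<otimes> g \<in> deg_below (n + k)"
proof (induction k arbitrary: g n)
  case 0
  then show ?case by (simp add: deg_below_carrier)
next
  case (Suc k)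
  then have "x [^] k \<otimes> (x \<otimes> g) \<in> deg_below (Suc n + k)"
    using x_mult_deg_below by blast
  then show ?case using Suc.prems by (simp add: m_assoc x_closed deg_below_carrier del: deg_below.simps(2))
qed

text \<open>The bound for \<open>s\<close> is written \<open>Suc m\<close> because strict bounds do
  not simply add: degrees at most \<open>n - 1\<close> and at most \<open>m\<close> give a product
  of degree below \<open>n + m\<close>.\<close>

lemma deg_below_mult:
  "g \<in> deg_below n \<Longrightarrow> s \<in> deg_below (Suc m) \<Longrightarrow> g \<otimes> s \<in> deg_below (n + m)"
proof (induction n arbitrary: g)
  case 0
  then show ?case using deg_below_carrier[OF 0(2)] by (auto simp: deg_below_zero simp del: deg_below.simps(2))
next
  case (Suc n)
  then obtain a g' where *: "a \<in> D" "g' \<in> deg_below n" "g = a \<otimes> x [^] n \<oplus> g'" by auto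
  have s: "s \<in> carrier R" using Suc.prems deg_below_carrier by blast
  have "g \<otimes> s = a \<otimes> (x [^] n \<otimes> s) \<oplus> g' \<otimes> s"
    using * s by (simp add: l_distr m_assoc D_mem_carrier x_closed deg_below_carrier)
  moreover have "a \<otimes> (x [^] n \<otimes> s) \<in> deg_below (Suc m + n)"
    using * Suc.prems by (intro deg_below_smult xpow_mult_deg_below) auto
  moreover have "g' \<otimes> s \<in> deg_below (Suc m + n)"
    using Suc.IH[OF *(2) Suc.prems(2)] deg_below_mono by (metis add.commute add_Suc le_SucI order_refl)
  ultimately show ?case
    using deg_below_add by (metis add.commute add_Suc add_Suc_right)
qed

text \<open>Each passage of a coefficient through one \<open>x\<close> applies
  \<open>\<sigma>\<close> once and sends the \<open>\<delta>\<close>-part to lower degree. This is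
  the source of the twist in \<open>lead_mult\<close>.\<close>

lemma xpow_mult_coeff:
  assumes "b \<in> D"
  shows "\<exists>w \<in> deg_below k. x [^] k \<otimes> b = (\<sigma> ^^ k) b \<otimes> x [^] k \<oplus> w"
proof (induction k)
  case 0
  then show ?case using assms by (simp add: D_mem_carrier)
next
  case (Suc k)
  then obtain w where w: "w \<in> deg_below k" "x [^] k \<otimes> b = (\<sigma> ^^ k) b \<otimes> x [^] k \<oplus> w" by blast
  define c where "c = (\<sigma> ^^ k) b"
  have c: "c \<in> D" "\<sigma> c \<in> D" "\<delta> c \<in> D"
    using assms delta_closed by (auto simp: c_def sigma_pow_closed sigma_closed)
  note [simp] = D_mem_carrier x_closed
  have "x [^] Suc k \<otimes> b = x \<otimes> (x [^] k \<otimes> b)"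
    using assms by (simp add: x_pow_comm flip: m_assoc)
  also have "\<dots> = (x \<otimes> c) \<otimes> x [^] k \<oplus> x \<otimes> w"
    using w c by (simp add: c_def[symmetric] r_distr m_assoc deg_below_carrier)
  also have "\<dots> = \<sigma> c \<otimes> x [^] Suc k \<oplus> (\<delta> c \<otimes> x [^] k \<oplus> x \<otimes> w)"
    using w c by (simp add: x_commutation l_distr m_assoc deg_below_carrier a_assoc x_pow_comm)
  finally have "x [^] Suc k \<otimes> b = \<sigma> c \<otimes> x [^] Suc k \<oplus> (\<delta> c \<otimes> x [^] k \<oplus> x \<otimes> w)" .
  moreover have "\<delta> c \<otimes> x [^] k \<oplus> x \<otimes> w \<in> deg_below (Suc k)"
    using c w by (intro deg_below_add monom_deg_below x_mult_deg_below) auto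
  ultimately show ?case unfolding c_def by (auto simp del: deg_below.simps nat_pow_Suc)
qed

lemma finsum_deg_below:
  "finite I \<Longrightarrow> I \<subseteq> {..<n} \<Longrightarrow> c \<in> I \<rightarrow> D \<Longrightarrow> (\<Oplus>i\<in>I. c i \<otimes> x [^] i) \<in> deg_below n"
proof (induction I rule: finite_induct)
  case (insert i I)
  then have "(\<Oplus>j\<in>insert i I. c j \<otimes> x [^] j) = c i \<otimes> x [^] i \<oplus> (\<Oplus>j\<in>I. c j \<otimes> x [^] j)"
    by (intro finsum_insert) (auto simp: Pi_iff D_mem_carrier x_closed)
  then show ?case using insert by (auto intro!: deg_below_add monom_deg_below)
qed (simp add: deg_below_zero)

section \<open>Uniqueness of coefficients and leading terms\<close>

lemma unique_coeffs:
  assumes "r \<in> carrier R"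
  shows "\<exists>!c. c \<in> UNIV \<rightarrow>\<^sub>E D \<and> finite {i \<in> UNIV. c i \<noteq> \<zero>} \<and>
    r = (\<Oplus>i\<in>{i \<in> UNIV. c i \<noteq> \<zero>}. c i \<otimes> x [^] (i::nat))"
  using powers_basis assms unfolding left_basis_def by (elim conjE) (drule (1) bspec)

lemma ex_deg_below: "r \<in> carrier R \<Longrightarrow> \<exists>n. r \<in> deg_below n"
proof -
  assume "r \<in> carrier R"
  then obtain c :: "nat \<Rightarrow> 'a" where c: "c \<in> UNIV \<rightarrow>\<^sub>E D" "finite {i \<in> UNIV. c i \<noteq> \<zero>}"
    "r = (\<Oplus>i\<in>{i \<in> UNIV. c i \<noteq> \<zero>}. c i \<otimes> x [^] i)"
    using ex1_implies_ex[OF unique_coeffs] by blast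
  obtain n where "{i \<in> UNIV. c i \<noteq> \<zero>} \<subseteq> {..<n}"
    using c(2) finite_nat_set_iff_bounded by auto
  then show ?thesis using finsum_deg_below[OF c(2), of n c] c by auto
qed

text \<open>The coefficient family is total and vanishes from \<open>n\<close> on, so that the next
  top coefficient is put in by an update at \<open>n\<close>.\<close>

lemma deg_below_as_sum:
  "g \<in> deg_below n \<Longrightarrow>
    \<exists>c. range c \<subseteq> D \<and> (\<forall>i\<ge>n. c i = \<zero>) \<and> g = (\<Oplus>i\<in>{..<n}. c i \<otimes> x [^] i)"
proof (induction n arbitrary: g)
  case 0
  then show ?case by (auto simp: D_zero intro!: exI[of _ "\<lambda>_. \<zero>"])
next
  case (Suc n)
  then obtain a h where *: "a \<in> D" "h \<in> deg_below n" "g = a \<otimes> x [^] n \<oplus> h" by auto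
  from Suc.IH[OF *(2)] obtain c where c: "range c \<subseteq> D" "\<forall>i\<ge>n. c i = \<zero>"
    "h = (\<Oplus>i\<in>{..<n}. c i \<otimes> x [^] i)" by blast
  have cD: "c i \<in> D" for i using c(1) by auto
  let ?c = "c(n := a)"
  have "(\<Oplus>i\<in>{..<Suc n}. ?c i \<otimes> x [^] i) = ?c n \<otimes> x [^] n \<oplus> (\<Oplus>i\<in>{..<n}. ?c i \<otimes> x [^] i)"
    unfolding lessThan_Suc using cD * by (intro finsum_insert) (auto simp: D_mem_carrier x_closed)
  also have "(\<Oplus>i\<in>{..<n}. ?c i \<otimes> x [^] i) = h"
    unfolding c(3) using cD by (intro finsum_cong') (auto simp: D_mem_carrier x_closed)
  finally show ?case using * c cD by (intro exI[of _ ?c]) auto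
qed

text \<open>This is the uniqueness half of \<open>powers_basis\<close>: if \<open>a\<close> were
  nonzero, the expansion with top coefficient \<open>a\<close> and the zero family would be two
  expansions of zero.\<close>

lemma leading_coeff_zero:
  assumes "a \<in> D" "g \<in> deg_below n" "a \<otimes> x [^] n \<oplus> g = \<zero>"
  shows "a = \<zero>"
proof (rule ccontr)
  assume "a \<noteq> \<zero>"
  have *: "\<zero> \<in> deg_below (Suc n)" by (rule deg_below_zero)
  obtain c where c: "range c \<subseteq> D" "\<forall>i\<ge>n. c i = \<zero>" "g = (\<Oplus>i\<in>{..<n}. c i \<otimes> x [^] i)"
    using deg_below_as_sum[OF assms(2)] by blast
  have cD: "c i \<in> D" for i using c(1) by auto
  let ?c = "c(n := a)" and ?P = "\<lambda>c :: nat \<Rightarrow> 'a. c \<in> UNIV \<rightarrow>\<^sub>E D \<and> finite {i \<in> UNIV. c i \<noteq> \<zero>} \<and>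
    \<zero> = (\<Oplus>i\<in>{i \<in> UNIV. c i \<noteq> \<zero>}. c i \<otimes> x [^] i)"
  have supp: "{i \<in> UNIV. ?c i \<noteq> \<zero>} \<subseteq> {..<Suc n}"
    using c(2) by (auto simp: not_less less_Suc_eq intro: ccontr)
  have "(\<Oplus>i\<in>{i \<in> UNIV. ?c i \<noteq> \<zero>}. ?c i \<otimes> x [^] i) = (\<Oplus>i\<in>{..<Suc n}. ?c i \<otimes> x [^] i)"
    using supp cD assms by (intro add.finprod_mono_neutral_cong_left) (auto simp: D_mem_carrier x_closed)
  also have "\<dots> = ?c n \<otimes> x [^] n \<oplus> (\<Oplus>i\<in>{..<n}. ?c i \<otimes> x [^] i)"
    unfolding lessThan_Suc using cD assms by (intro finsum_insert) (auto simp: D_mem_carrier x_closed)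
  also have "(\<Oplus>i\<in>{..<n}. ?c i \<otimes> x [^] i) = g"
    unfolding c(3) using cD by (intro finsum_cong') (auto simp: D_mem_carrier x_closed)
  finally have "\<zero> = (\<Oplus>i\<in>{i \<in> UNIV. ?c i \<noteq> \<zero>}. ?c i \<otimes> x [^] i)" using assms(3) by simp
  then have "?P ?c" using supp cD assms(1) finite_subset[OF supp] by auto
  moreover have "?P (\<lambda>_. \<zero>)" by (auto simp: D_zero)
  moreover have "\<exists>!c. ?P c" by (rule unique_coeffs) simp
  ultimately have "?c = (\<lambda>_. \<zero>)" by blast
  then show False using \<open>a \<noteq> \<zero>\<close> by (metis fun_upd_same)
qed

text \<open>Degree and leading coefficient are given by a relation, which leaves the zero polynomial
  without either.\<close>

definition lead :: "nat \<Rightarrow> 'a \<Rightarrow> 'a \<Rightarrow> bool" where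
  "lead n a r \<longleftrightarrow> a \<in> D \<and> a \<noteq> \<zero> \<and> (\<exists>g \<in> deg_below n. r = a \<otimes> x [^] n \<oplus> g)"

lemma lead_deg_below: "lead n a r \<Longrightarrow> r \<in> deg_below (Suc n)"
  by (auto simp: lead_def)

lemma lead_carrier: "lead n a r \<Longrightarrow> r \<in> carrier R"
  using lead_deg_below deg_below_carrier by blast

text \<open>This pins down \<open>n\<close> as the degree of \<open>r\<close>. Otherwise subtracting
  \<open>r\<close> from its own expansion would give zero with the nonzero top coefficient
  \<open>a\<close>.\<close>

lemma not_deg_below_if_lead:
  assumes "lead n a r"
  shows "r \<notin> deg_below n"
proof
  assume r: "r \<in> deg_below n"
  obtain g where g: "a \<in> D" "a \<noteq> \<zero>" "g \<in> deg_below n" "r = a \<otimes> x [^] n \<oplus> g"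
    using assms by (auto simp: lead_def)
  have "a \<otimes> x [^] n \<oplus> (g \<ominus> r) = (a \<otimes> x [^] n \<oplus> g) \<ominus> r"
    using g(1,3) r by (simp add: minus_eq a_assoc D_mem_carrier x_closed deg_below_carrier)
  also have "\<dots> = \<zero>"
    unfolding g(4)[symmetric] using r by (simp add: minus_eq r_neg deg_below_carrier)
  finally show False using leading_coeff_zero[of a "g \<ominus> r" n] g r deg_below_diff by blast
qed

lemma lead_nonzero: "lead n a r \<Longrightarrow> r \<noteq> \<zero>"
  using not_deg_below_if_lead deg_below_zero by blast

lemma ex_lead_deg_below: "r \<in> deg_below k \<Longrightarrow> r \<noteq> \<zero> \<Longrightarrow> \<exists>n<k. \<exists>a. lead n a r"
proof (induction k)
  case (Suc k)
  then obtain a g where *: "a \<in> D" "g \<in> deg_below k" "r = a \<otimes> x [^] k \<oplus> g" by auto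
  show ?case
  proof (cases "a = \<zero>")
    case True
    then have "r = g" using * by (simp add: x_closed deg_below_carrier)
    then show ?thesis using Suc * less_SucI by blast
  next
    case False
    then show ?thesis using * by (auto simp: lead_def)
  qed
qed simp

lemma ex_lead: "r \<in> carrier R \<Longrightarrow> r \<noteq> \<zero> \<Longrightarrow> \<exists>n a. lead n a r"
  using ex_deg_below ex_lead_deg_below by blast

lemma monom_mult_lead:
  assumes "a \<in> D" "a \<noteq> \<zero>"
  shows "lead n a (a \<otimes> x [^] n)"
  using assms by (auto simp: lead_def D_mem_carrier x_closed intro!: bexI[of _ \<zero>] deg_below_zero)

text \<open>Degrees add because \<open>D\<close> has no zero divisors and \<open>\<sigma>\<close> is
  injective; the twist comes from carrying \<open>b\<close> past the top power of \<open>x\<close>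
  in \<open>r\<close>.\<close>

lemma lead_mult:
  assumes "lead n a r" "lead m b s"
  shows "lead (n + m) (a \<otimes> (\<sigma> ^^ n) b) (r \<otimes> s)"
proof -
  note [simp] = D_mem_carrier x_closed deg_below_carrier
  obtain g where g: "a \<in> D" "a \<noteq> \<zero>" "g \<in> deg_below n" "r = a \<otimes> x [^] n \<oplus> g"
    using assms by (auto simp: lead_def)
  obtain h where h: "b \<in> D" "b \<noteq> \<zero>" "h \<in> deg_below m" "s = b \<otimes> x [^] m \<oplus> h"
    using assms by (auto simp: lead_def)
  obtain w where w: "w \<in> deg_below n" "x [^] n \<otimes> b = (\<sigma> ^^ n) b \<otimes> x [^] n \<oplus> w"
    using xpow_mult_coeff[OF h(1)] by blast
  define b' where "b' = (\<sigma> ^^ n) b"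
  have b': "b' \<in> D" "b' \<noteq> \<zero>" using h by (auto simp: b'_def sigma_pow_closed sigma_pow_nonzero)
  have s: "s \<in> carrier R" "s \<in> deg_below (Suc m)" using assms lead_carrier lead_deg_below by blast+
  have xm: "x [^] m \<in> deg_below (Suc m)"
    using monom_deg_below[of \<one> m "Suc m"] by (simp add: D_one)
  have "r \<otimes> s = a \<otimes> (x [^] n \<otimes> s) \<oplus> g \<otimes> s"
    using g s(1) by (simp add: l_distr m_assoc)
  also have "x [^] n \<otimes> s = (x [^] n \<otimes> b) \<otimes> x [^] m \<oplus> x [^] n \<otimes> h"
    using h by (simp add: r_distr m_assoc)
  also have "\<dots> = b' \<otimes> (x [^] n \<otimes> x [^] m) \<oplus> (w \<otimes> x [^] m \<oplus> x [^] n \<otimes> h)"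
    unfolding w(2) b'_def[symmetric] using w(1) b' h by (simp add: l_distr m_assoc a_assoc)
  also have "a \<otimes> \<dots> \<oplus> g \<otimes> s =
      (a \<otimes> b') \<otimes> x [^] (n + m) \<oplus> (a \<otimes> (w \<otimes> x [^] m \<oplus> x [^] n \<otimes> h) \<oplus> g \<otimes> s)"
    using g b' w(1) h s(1) by (simp add: r_distr m_assoc a_assoc nat_pow_mult)
  finally have "r \<otimes> s = (a \<otimes> b') \<otimes> x [^] (n + m) \<oplus> (a \<otimes> (w \<otimes> x [^] m \<oplus> x [^] n \<otimes> h) \<oplus> g \<otimes> s)" .
  moreover have "a \<otimes> (w \<otimes> x [^] m \<oplus> x [^] n \<otimes> h) \<oplus> g \<otimes> s \<in> deg_below (n + m)"
    using deg_below_mult[OF w(1) xm] xpow_mult_deg_below[OF h(3), of n] deg_below_mult[OF g(3) s(2)] g(1)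
    by (simp add: add.commute deg_below_add deg_below_smult del: deg_below.simps)
  moreover have "a \<otimes> b' \<noteq> \<zero>"
  proof
    assume ab: "a \<otimes> b' = \<zero>"
    obtain a' where "a' \<in> D" "a' \<otimes> a = \<one>" using D_inverse g by blast
    then have "b' = a' \<otimes> (a \<otimes> b')" using g b' by (simp add: m_assoc[symmetric])
    then show False using ab b' \<open>a' \<in> D\<close> by simp
  qed
  ultimately show ?thesis using g b' unfolding lead_def b'_def[symmetric] by (auto simp: D_mult)
qed

section \<open>Absence of zero divisors and division with remainder\<close>

lemma integral:
  assumes "r \<in> carrier R" "s \<in> carrier R" "r \<otimes> s = \<zero>"
  shows "r = \<zero> \<or> s = \<zero>"
  using ex_lead[OF assms(1)] ex_lead[OF assms(2)] lead_mult lead_nonzero assms(3) by metis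

lemma right_cancel:
  assumes "c \<in> carrier R" "c \<noteq> \<zero>" "r \<in> carrier R" "s \<in> carrier R" "r \<otimes> c = s \<otimes> c"
  shows "r = s"
proof -
  have "(r \<ominus> s) \<otimes> c = \<zero>" using assms by (simp add: minus_eq l_distr l_minus r_neg)
  then show ?thesis using integral[of "r \<ominus> s" c] assms r_right_minus_eq by auto
qed

text \<open>Long division, by induction on the degree bound of the dividend: each step cancels its
  top term by a left multiple of \<open>N\<close>.\<close>

lemma left_division:
  assumes N: "lead t c N"
  shows "r \<in> deg_below k \<Longrightarrow> \<exists>q \<in> carrier R. r \<ominus> q \<otimes> N \<in> deg_below t"
proof (induction k arbitrary: r)
  case 0
  then show ?case using lead_carrier[OF N]
    by (intro bexI[of _ \<zero>]) (auto simp: minus_eq deg_below_zero)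
next
  case (Suc k)
  note [simp] = D_mem_carrier x_closed deg_below_carrier
  have Nc: "N \<in> carrier R" using N lead_carrier by blast
  have rc: "r \<in> carrier R" using Suc.prems deg_below_carrier by blast
  obtain a g where *: "a \<in> D" "g \<in> deg_below k" "r = a \<otimes> x [^] k \<oplus> g" using Suc.prems by auto
  consider "Suc k \<le> t" | "a = \<zero>" | "a \<noteq> \<zero>" "t \<le> k" by linarith
  then show ?case
  proof cases
    case 1
    then show ?thesis using Suc.prems Nc rc deg_below_mono[OF Suc.prems]
      by (intro bexI[of _ \<zero>]) (auto simp: minus_eq simp del: deg_below.simps)
  next
    case 2
    then show ?thesis using * Suc.IH by simp
  next
    case 3
    \<comment> \<open>A monomial of degree \<open>k - t\<close> to the left of \<open>N\<close>
      twists the leading coefficient \<open>c\<close> into \<open>c'\<close>, so \<open>c'\<close>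
      is what has to be inverted.\<close>
    define c' where "c' = (\<sigma> ^^ (k - t)) c"
    have c': "c' \<in> D" "c' \<noteq> \<zero>"
      using N by (auto simp: c'_def lead_def sigma_pow_closed sigma_pow_nonzero)
    then obtain d where d: "d \<in> D" "d \<otimes> c' = \<one>" using D_inverse by blast
    define q where "q = (a \<otimes> d) \<otimes> x [^] (k - t)"
    have ad: "a \<otimes> d \<in> D" "a \<otimes> d \<noteq> \<zero>"
    proof -
      show "a \<otimes> d \<in> D" using * d D_mult by blast
      show "a \<otimes> d \<noteq> \<zero>"
        using integral[of a d] 3 * d c' by force
    qed
    have "lead (k - t + t) (a \<otimes> d \<otimes> c') (q \<otimes> N)"
      unfolding q_def c'_def by (intro lead_mult monom_mult_lead ad N)
    moreover have "a \<otimes> d \<otimes> c' = a" using * d c' by (simp add: m_assoc)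
    ultimately obtain h where h: "h \<in> deg_below k" "q \<otimes> N = a \<otimes> x [^] k \<oplus> h"
      using 3 by (auto simp: lead_def)
    have q: "q \<in> carrier R" using ad by (simp add: q_def)
    have "r \<ominus> q \<otimes> N = g \<ominus> h"
      unfolding h(2) *(3) using *(1,2) h(1) by (simp add: minus_eq minus_add a_ac r_neg r_neg1 r_neg2)
    then have "r \<ominus> q \<otimes> N \<in> deg_below k" using * h deg_below_diff by simp
    then obtain p where p: "p \<in> carrier R" "r \<ominus> q \<otimes> N \<ominus> p \<otimes> N \<in> deg_below t"
      using Suc.IH by blast
    have "r \<ominus> q \<otimes> N \<ominus> p \<otimes> N = r \<ominus> (q \<oplus> p) \<otimes> N"
      using rc q p(1) Nc by (simp add: minus_eq l_distr minus_add a_assoc)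
    then show ?thesis using p q by (metis a_closed)
  qed
qed

text \<open>Now the unknown coefficient of the quotient stands to the right of \<open>N\<close> and
  is itself twisted, by \<open>\<sigma> ^^ t\<close>; surjectivity of \<open>\<sigma>\<close> makes
  the equation for it solvable.\<close>

lemma right_division:
  assumes N: "lead t c N"
  shows "r \<in> deg_below k \<Longrightarrow> \<exists>q \<in> carrier R. r \<ominus> N \<otimes> q \<in> deg_below t"
proof (induction k arbitrary: r)
  case 0
  then show ?case using lead_carrier[OF N]
    by (intro bexI[of _ \<zero>]) (auto simp: minus_eq deg_below_zero)
next
  case (Suc k)
  note [simp] = D_mem_carrier x_closed deg_below_carrier
  have Nc: "N \<in> carrier R" using N lead_carrier by blast
  have rc: "r \<in> carrier R" using Suc.prems deg_below_carrier by blast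
  obtain a g where *: "a \<in> D" "g \<in> deg_below k" "r = a \<otimes> x [^] k \<oplus> g" using Suc.prems by auto
  consider "Suc k \<le> t" | "a = \<zero>" | "a \<noteq> \<zero>" "t \<le> k" by linarith
  then show ?case
  proof cases
    case 1
    then show ?thesis using Suc.prems Nc rc deg_below_mono[OF Suc.prems]
      by (intro bexI[of _ \<zero>]) (auto simp: minus_eq simp del: deg_below.simps)
  next
    case 2
    then show ?thesis using * Suc.IH by simp
  next
    case 3
    have c: "c \<in> D" "c \<noteq> \<zero>" using N by (auto simp: lead_def)
    then obtain d where d: "d \<in> D" "c \<otimes> d = \<one>" using D_inverse by blast
    have da: "d \<otimes> a \<in> D" "d \<otimes> a \<noteq> \<zero>"
    proof -
      show "d \<otimes> a \<in> D" using * d D_mult by blast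
      show "d \<otimes> a \<noteq> \<zero>"
        using integral[of d a] 3 * d c by force
    qed
    obtain b where b: "b \<in> D" "(\<sigma> ^^ t) b = d \<otimes> a" using sigma_pow_surj[OF da(1)] by blast
    have "b \<noteq> \<zero>" using b da by (auto simp: sigma_pow_zero)
    define q where "q = b \<otimes> x [^] (k - t)"
    have "lead (t + (k - t)) (c \<otimes> (\<sigma> ^^ t) b) (N \<otimes> q)"
      unfolding q_def using b \<open>b \<noteq> \<zero>\<close> by (intro lead_mult monom_mult_lead N)
    moreover have "c \<otimes> (\<sigma> ^^ t) b = a"
      unfolding b(2) using * d c by (simp flip: m_assoc)
    ultimately obtain h where h: "h \<in> deg_below k" "N \<otimes> q = a \<otimes> x [^] k \<oplus> h"
      using 3 by (auto simp: lead_def)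
    have q: "q \<in> carrier R" using b by (simp add: q_def)
    have "r \<ominus> N \<otimes> q = g \<ominus> h"
      unfolding h(2) *(3) using *(1,2) h(1) by (simp add: minus_eq minus_add a_ac r_neg r_neg1 r_neg2)
    then have "r \<ominus> N \<otimes> q \<in> deg_below k" using * h deg_below_diff by simp
    then obtain p where p: "p \<in> carrier R" "r \<ominus> N \<otimes> q \<ominus> N \<otimes> p \<in> deg_below t"
      using Suc.IH by blast
    have "r \<ominus> N \<otimes> q \<ominus> N \<otimes> p = r \<ominus> N \<otimes> (q \<oplus> p)"
      using rc q p(1) Nc by (simp add: minus_eq r_distr minus_add a_assoc)
    then show ?thesis using p q by (metis a_closed)
  qed
qed

end

section \<open>Ideals of Ore extensions\<close>

context ore_extension
begin

section \<open>Units, principal left ideals and irreducibility\<close>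

lemma one_not_zero: "\<one> \<noteq> \<zero>"
  using skew_field.one_neq_zero[OF D_skew_field] by simp

text \<open>Nonzero multiples of \<open>x\<close> have degree at least one. This later excludes that
  two elements generating the unit left ideal both lie in \<open>Rx\<close>.\<close>

lemma one_not_in_left_ideal_x: "\<one> \<notin> carrier R #> x"
proof
  assume "\<one> \<in> carrier R #> x"
  then obtain q where q: "q \<in> carrier R" "\<one> = q \<otimes> x" by (auto simp: mem_left_ideal_iff)
  then have "q \<noteq> \<zero>" using one_not_zero x_closed by auto
  then obtain n b where "lead n b q" using ex_lead q by blast
  moreover have "lead 1 \<one> x"
    using monom_mult_lead[of \<one> 1] x_closed by (simp add: D_one one_not_zero)
  ultimately obtain c where "lead (n + 1) c \<one>" using lead_mult q(2) by metis
  moreover have "\<one> \<in> deg_below (n + 1)"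
    using monom_deg_below[of \<one> 0 "n + 1"] by (simp add: D_one del: deg_below.simps)
  ultimately show False using not_deg_below_if_lead by blast
qed

text \<open>From \<open>sg = 1\<close> follows \<open>gsg = g\<close>, and \<open>g\<close> can be
  cancelled on the right in a domain.\<close>

lemma unit_if_left_inverse:
  assumes "s \<in> carrier R" "g \<in> carrier R" "s \<otimes> g = \<one>"
  shows "g \<in> Units R"
proof -
  have "g \<noteq> \<zero>" using assms one_not_zero by auto
  moreover have "g \<otimes> s \<otimes> g = \<one> \<otimes> g" using assms by (simp add: m_assoc)
  ultimately have "g \<otimes> s = \<one>" using right_cancel[of g "g \<otimes> s" \<one>] assms by auto
  then show ?thesis using assms by (auto simp: Units_def)
qed

text \<open>A nonzero element of least degree generates, because remainders on division by it stay
  in \<open>J\<close>. Only closure properties are assumed, so that left ideals and twosided ideals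
  are both covered.\<close>

lemma left_ideal_principal:
  assumes J: "J \<subseteq> carrier R" "g \<in> J" "g \<noteq> \<zero>"
    and diff: "\<And>a b. a \<in> J \<Longrightarrow> b \<in> J \<Longrightarrow> a \<ominus> b \<in> J"
    and mult: "\<And>a r. a \<in> J \<Longrightarrow> r \<in> carrier R \<Longrightarrow> r \<otimes> a \<in> J"
  shows "\<exists>N \<in> J. N \<noteq> \<zero> \<and> J = carrier R #> N"
proof -
  define P where "P t \<longleftrightarrow> (\<exists>c N. N \<in> J \<and> lead t c N)" for t
  have "\<exists>t. P t" using ex_lead[of g] J unfolding P_def by blast
  define t where "t = (LEAST t. P t)"
  have "P t" unfolding t_def using \<open>\<exists>t. P t\<close> by (rule LeastI_ex)
  then obtain c N where N: "N \<in> J" "lead t c N" unfolding P_def by blast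
  have "r \<in> carrier R #> N" if r: "r \<in> J" for r
  proof -
    obtain k where "r \<in> deg_below k" using ex_deg_below r J(1) by blast
    then obtain q where q: "q \<in> carrier R" "r \<ominus> q \<otimes> N \<in> deg_below t"
      using left_division[OF N(2)] by blast
    have "r \<ominus> q \<otimes> N \<in> J" by (intro diff mult r N(1) q(1))
    moreover have "\<not> P n" if "n < t" for n using that unfolding t_def by (rule not_less_Least)
    ultimately have "r \<ominus> q \<otimes> N = \<zero>"
      using ex_lead_deg_below[OF q(2)] unfolding P_def by blast
    moreover have "r \<in> carrier R" "q \<otimes> N \<in> carrier R" using q(1) r N(1) J(1) by auto
    ultimately have "r = q \<otimes> N" by (simp add: r_right_minus_eq)
    then show ?thesis using q(1) by (auto simp: mem_left_ideal_iff)
  qed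
  moreover have "r \<in> J" if "r \<in> carrier R #> N" for r
    using that mult[OF N(1)] by (auto simp: mem_left_ideal_iff)
  ultimately show ?thesis using N(1) lead_nonzero[OF N(2)] by blast
qed

lemma nc_irreducible_iff_left_maximal:
  assumes f: "f \<in> carrier R" "f \<noteq> \<zero>"
  shows "nc_irreducible R f \<longleftrightarrow> left_maximal R (carrier R #> f)"
proof
  assume irr: "nc_irreducible R f"
  show "left_maximal R (carrier R #> f)"
    unfolding left_maximal_def
  proof (intro conjI ballI)
    show "\<one> \<notin> carrier R #> f"
      using irr unit_if_left_inverse f unfolding mem_left_ideal_iff nc_irreducible_def by metis
    fix y assume y: "y \<in> carrier R - (carrier R #> f)"
    \<comment> \<open>The left ideal \<open>Rf + Ry\<close>; a generator \<open>N\<close> of it is a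
      right factor of \<open>f\<close>.\<close>
    define J where "J = {s \<otimes> f \<oplus> t \<otimes> y | s t. s \<in> carrier R \<and> t \<in> carrier R}"
    have memJ: "s \<otimes> f \<oplus> t \<otimes> y \<in> J" if "s \<in> carrier R" "t \<in> carrier R" for s t
      using that by (auto simp: J_def)
    have fJ: "f \<in> J" and yJ: "y \<in> J"
      using memJ[of \<one> \<zero>] memJ[of \<zero> \<one>] f y by auto
    have "J \<subseteq> carrier R" using f y by (auto simp: J_def)
    moreover have "a \<ominus> b \<in> J" if ab: "a \<in> J" "b \<in> J" for a b
    proof -
      obtain s t s' t' where *: "s \<in> carrier R" "t \<in> carrier R" "s' \<in> carrier R" "t' \<in> carrier R"
        "a = s \<otimes> f \<oplus> t \<otimes> y" "b = s' \<otimes> f \<oplus> t' \<otimes> y" using ab by (auto simp: J_def)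
      then have "a \<ominus> b = (s \<ominus> s') \<otimes> f \<oplus> (t \<ominus> t') \<otimes> y"
        using f y by (simp add: minus_eq l_distr l_minus minus_add a_ac)
      then show ?thesis using memJ * by simp
    qed
    moreover have "r \<otimes> a \<in> J" if ar: "a \<in> J" "r \<in> carrier R" for a r
    proof -
      obtain s t where *: "s \<in> carrier R" "t \<in> carrier R" "a = s \<otimes> f \<oplus> t \<otimes> y"
        using ar by (auto simp: J_def)
      then have "r \<otimes> a = (r \<otimes> s) \<otimes> f \<oplus> (r \<otimes> t) \<otimes> y"
        using f y ar by (simp add: r_distr m_assoc)
      then show ?thesis using memJ * ar by simp
    qed
    ultimately obtain N where N: "N \<in> J" "N \<noteq> \<zero>" "J = carrier R #> N"
      using left_ideal_principal[of J f] fJ f by blast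
    have Nc: "N \<in> carrier R" using N \<open>J \<subseteq> carrier R\<close> by blast
    obtain h where h: "h \<in> carrier R" "f = h \<otimes> N" using fJ N(3) by (auto simp: mem_left_ideal_iff)
    obtain p where p: "p \<in> carrier R" "y = p \<otimes> N" using yJ N(3) by (auto simp: mem_left_ideal_iff)
    \<comment> \<open>For a unit \<open>h\<close> one would have \<open>RN = Rf\<close>, although
      \<open>y\<close> lies in \<open>RN\<close> and not in \<open>Rf\<close>.\<close>
    have "h \<notin> Units R"
    proof
      assume "h \<in> Units R"
      then obtain h' where h': "h' \<in> carrier R" "h' \<otimes> h = \<one>" by (auto simp: Units_def)
      then have "h' \<otimes> f = N" using h Nc by (simp flip: m_assoc)
      then have "y = (p \<otimes> h') \<otimes> f" using p h' f by (simp add: m_assoc)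
      then show False using y p h' by (auto simp: mem_left_ideal_iff)
    qed
    then have "N \<in> Units R" using irr h Nc unfolding nc_irreducible_def by blast
    then have "\<one> \<in> J" unfolding N(3) mem_left_ideal_iff using Units_l_inv Units_inv_closed by metis
    then obtain s t where "s \<in> carrier R" "t \<in> carrier R" "\<one> = s \<otimes> f \<oplus> t \<otimes> y"
      unfolding J_def by blast
    moreover from this have "s \<otimes> f \<in> carrier R #> f" by (auto simp: mem_left_ideal_iff)
    ultimately show "\<exists>g\<in>carrier R #> f. \<exists>t\<in>carrier R. \<one> = g \<oplus> t \<otimes> y" by blast
  qed
next
  assume max: "left_maximal R (carrier R #> f)"
  have "f \<notin> Units R"
    using max Units_l_inv Units_inv_closed unfolding left_maximal_def mem_left_ideal_iff by metis
  moreover have "g \<in> Units R \<or> h \<in> Units R"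
    if gh: "g \<in> carrier R" "h \<in> carrier R" "f = g \<otimes> h" for g h
  proof (cases "h \<in> carrier R #> f")
    \<comment> \<open>Here \<open>h = kf = kgh\<close>, and cancelling \<open>h\<close> makes
      \<open>k\<close> a left inverse of \<open>g\<close>.\<close>
    case True
    then obtain k where k: "k \<in> carrier R" "h = k \<otimes> f" by (auto simp: mem_left_ideal_iff)
    have "h \<noteq> \<zero>" using gh f by auto
    moreover have "k \<otimes> g \<otimes> h = \<one> \<otimes> h" using k gh by (simp add: m_assoc)
    ultimately have "k \<otimes> g = \<one>" using right_cancel[of h "k \<otimes> g" \<one>] k(1) gh(1,2) by auto
    then show ?thesis using unit_if_left_inverse k(1) gh(1) by blast
  next
    case False
    then obtain g' t where *: "g' \<in> carrier R #> f" "t \<in> carrier R" "\<one> = g' \<oplus> t \<otimes> h"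
      using max gh unfolding left_maximal_def by blast
    then obtain s where s: "s \<in> carrier R" "g' = s \<otimes> f" by (auto simp: mem_left_ideal_iff)
    \<comment> \<open>Since \<open>f = gh\<close> is itself a left multiple of \<open>h\<close>, the
      relation collapses to a left inverse of \<open>h\<close>.\<close>
    have "(s \<otimes> g \<oplus> t) \<otimes> h = \<one>"
      unfolding *(3) s(2) using s(1) gh *(2) by (simp add: l_distr m_assoc)
    then show ?thesis using unit_if_left_inverse[of "s \<otimes> g \<oplus> t" h] s gh * by auto
  qed
  ultimately show "nc_irreducible R f" using f by (auto simp: nc_irreducible_def)
qed

text \<open>
  The inclusion \<open>RN \<subseteq> NR\<close> comes from division with the quotient on the right, which is available
  because \<open>\<sigma>\<close> is surjective.
\<close>

lemma twosided_if_ideal: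
  assumes N: "N \<in> carrier R" "N \<noteq> \<zero>" and I: "ideal (carrier R #> N) R"
  shows "twosided R N"
proof -
  interpret I: ideal "carrier R #> N" R by (rule I)
  have self: "N \<in> carrier R #> N" using N by (auto simp: mem_left_ideal_iff intro!: bexI[of _ \<one>])
  obtain t c where t: "lead t c N" using ex_lead N by blast
  have "r \<in> N <# carrier R" if r: "r \<in> carrier R #> N" for r
  proof -
    have rc: "r \<in> carrier R" using r I.Icarr by blast
    obtain k where "r \<in> deg_below k" using ex_deg_below rc by blast
    then obtain q where q: "q \<in> carrier R" "r \<ominus> N \<otimes> q \<in> deg_below t"
      using right_division[OF t] by blast
    have "r \<ominus> N \<otimes> q \<in> carrier R #> N"
      using r q self by (simp add: minus_eq I.I_r_closed)
    then obtain p where p: "p \<in> carrier R" "r \<ominus> N \<otimes> q = p \<otimes> N" by (auto simp: mem_left_ideal_iff)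
    \<comment> \<open>A nonzero left multiple of \<open>N\<close> has degree at least
      \<open>t\<close>, while the remainder has degree below \<open>t\<close>.\<close>
    have "p = \<zero>"
    proof (rule ccontr)
      assume "p \<noteq> \<zero>"
      then obtain n b where "lead n b p" using ex_lead p by blast
      from lead_mult[OF this t] have "p \<otimes> N \<notin> deg_below (n + t)" by (rule not_deg_below_if_lead)
      then show False using q(2) p(2) deg_below_mono[of "p \<otimes> N" t "n + t"] by simp
    qed
    then have "r \<ominus> N \<otimes> q = \<zero>" using p(2) N(1) by simp
    then have "r = N \<otimes> q" using q(1) N(1) rc by (simp add: r_right_minus_eq)
    then show ?thesis using q by (auto simp: mem_right_ideal_iff)
  qed
  moreover have "r \<in> carrier R #> N" if r: "r \<in> N <# carrier R" for r
    using r self I.I_r_closed by (auto simp: mem_right_ideal_iff)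
  ultimately show ?thesis using N by (auto simp: twosided_def)
qed

section \<open>Factors of central elements\<close>

lemma cofactor_central:
  assumes "\<gamma> \<in> carrier R" "\<alpha> \<in> ring_center R" "\<alpha> \<noteq> \<zero>" "\<gamma> \<otimes> \<alpha> \<in> ring_center R"
  shows "\<gamma> \<in> ring_center R"
proof -
  have \<alpha>: "\<alpha> \<in> carrier R" "\<And>s. s \<in> carrier R \<Longrightarrow> \<alpha> \<otimes> s = s \<otimes> \<alpha>"
    using assms by (auto simp: ring_center_iff)
  have "\<gamma> \<otimes> r = r \<otimes> \<gamma>" if r: "r \<in> carrier R" for r
  proof -
    have "\<gamma> \<otimes> r \<otimes> \<alpha> = \<gamma> \<otimes> \<alpha> \<otimes> r" using \<alpha> r assms(1) by (simp add: m_assoc)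
    also have "\<dots> = r \<otimes> \<gamma> \<otimes> \<alpha>" using assms(1,4) r \<alpha>(1) by (simp add: ring_center_iff m_assoc)
    finally show ?thesis using right_cancel[of \<alpha> "\<gamma> \<otimes> r" "r \<otimes> \<gamma>"] assms(1,3) \<alpha>(1) r by simp
  qed
  then show ?thesis using assms(1) by (simp add: ring_center_iff)
qed

text \<open>Irreducibility is given inside the center, whereas the factorization lives in
  \<open>R\<close>. By \<open>cofactor_central\<close> the factor \<open>\<gamma>\<close> is central
  too, so the factorization already takes place in the center.\<close>

lemma central_irreducible_factor:
  assumes irr: "ring_irreducible\<^bsub>R\<lparr>carrier := ring_center R\<rparr>\<^esub> c"
    and \<alpha>: "\<alpha> \<in> ring_center R" and \<gamma>: "\<gamma> \<in> carrier R" and c: "c = \<gamma> \<otimes> \<alpha>" "c \<in> ring_center R"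
  shows "\<alpha> \<in> Units R \<or> \<gamma> \<in> Units R"
proof -
  let ?Z = "R\<lparr>carrier := ring_center R\<rparr>"
  have cz: "c \<noteq> \<zero>" and irr': "irreducible ?Z c" using irr by (auto simp: ring_irreducible_def)
  have \<alpha>': "\<alpha> \<in> carrier R" "\<alpha> \<noteq> \<zero>" "\<And>s. s \<in> carrier R \<Longrightarrow> \<alpha> \<otimes> s = s \<otimes> \<alpha>"
    using \<alpha> cz c \<gamma> by (auto simp: ring_center_iff)
  have \<gamma>Z: "\<gamma> \<in> ring_center R" using cofactor_central[OF \<gamma> \<alpha> \<alpha>'(2)] c by simp
  have "c = \<alpha> \<otimes> \<gamma>" using c(1) \<alpha>'(3)[OF \<gamma>] by simp
  then have dvd: "\<alpha> divides\<^bsub>?Z\<^esub> c" using \<gamma>Z by (auto simp: factor_def)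
  show ?thesis
  proof (cases "c divides\<^bsub>?Z\<^esub> \<alpha>")
    \<comment> \<open>Cancelling \<open>\<alpha>\<close> from
      \<open>\<alpha> = c\<beta> = \<gamma>\<beta>\<alpha>\<close> shows that
      \<open>\<gamma>\<close> is invertible.\<close>
    case True
    then obtain \<beta> where \<beta>: "\<beta> \<in> ring_center R" "\<alpha> = c \<otimes> \<beta>" by (auto simp: factor_def)
    have \<beta>': "\<beta> \<in> carrier R" using \<beta> by (simp add: ring_center_iff)
    have "\<one> \<otimes> \<alpha> = (\<gamma> \<otimes> \<beta>) \<otimes> \<alpha>"
      using \<beta>(2) \<alpha>' \<beta>' \<gamma> c(1) by (simp add: m_assoc)
    then have "\<gamma> \<otimes> \<beta> = \<one>"
      using right_cancel[of \<alpha> \<one> "\<gamma> \<otimes> \<beta>"] \<alpha>' \<beta>' \<gamma> by simp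
    then have "\<beta> \<otimes> \<gamma> = \<one>" using \<beta> \<gamma> by (simp add: ring_center_iff)
    then show ?thesis using unit_if_left_inverse \<beta>' \<gamma> by blast
  next
    case False
    then have "\<alpha> \<in> Units ?Z" using irr' dvd \<alpha> by (auto simp: irreducible_def properfactor_def)
    then obtain \<beta> where "\<beta> \<in> ring_center R" "\<beta> \<otimes> \<alpha> = \<one>" by (auto simp: Units_def)
    then show ?thesis using unit_if_left_inverse \<alpha>'(1) by (auto simp: ring_center_iff)
  qed
qed

text \<open>This supplies the assumption \<open>full\<close> of
  \<open>left_maximal_if_skew_field_corner\<close>, lifted from the quotient by \<open>Rc\<close> to
  \<open>R\<close>; hence \<open>u\<close> is idempotent only modulo \<open>Rc\<close>. The
  assumption \<open>twosided_form\<close> is hypothesis (3) with the center in the place of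
  \<open>K[z]\<close>.\<close>

lemma idempotent_generates:
  assumes twosided_form: "\<And>g. twosided R g \<Longrightarrow> g \<noteq> \<zero> \<Longrightarrow>
      \<exists>d \<in> D - {\<zero>}. \<exists>m :: nat. \<exists>\<alpha> \<in> ring_center R. g = d \<otimes> (x [^] m \<otimes> \<alpha>)"
    and irr: "ring_irreducible\<^bsub>R\<lparr>carrier := ring_center R\<rparr>\<^esub> c" and c: "c \<in> ring_center R"
    and u: "u \<in> carrier R" "u \<otimes> u \<ominus> u \<in> carrier R #> c" "u \<notin> carrier R #> c"
  shows "\<one> \<in> Idl {u, c}"
proof -
  have cz: "c \<noteq> \<zero>" using irr by (auto simp: ring_irreducible_def)
  have cc: "c \<in> carrier R" and comm: "\<And>s. s \<in> carrier R \<Longrightarrow> c \<otimes> s = s \<otimes> c"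
    using c by (auto simp: ring_center_iff)
  define J where "J = Idl {u, c}"
  interpret J: ideal J R unfolding J_def using u cc by (intro genideal_ideal) auto
  have gens: "u \<in> J" "c \<in> J" unfolding J_def using genideal_self[of "{u, c}"] u cc by auto
  obtain N where N: "N \<in> J" "N \<noteq> \<zero>" and J_eq: "J = carrier R #> N"
    using left_ideal_principal[of J c] gens cz J.a_subset J.I_l_closed by (auto simp: minus_eq)
  have Nc: "N \<in> carrier R" using N J.Icarr by blast
  have twoN: "twosided R N" using twosided_if_ideal[OF Nc N(2)] J.is_ideal J_eq by simp
  then have NR: "\<And>y. y \<in> carrier R #> N \<longleftrightarrow> y \<in> N <# carrier R" by (simp add: twosided_def)
  have right: "\<exists>s' \<in> carrier R. N \<otimes> s = s' \<otimes> N" if "s \<in> carrier R" for s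
    using NR[of "N \<otimes> s"] that by (auto simp: mem_left_ideal_iff mem_right_ideal_iff)
  have left: "\<exists>s' \<in> carrier R. s \<otimes> N = N \<otimes> s'" if "s \<in> carrier R" for s
    using NR[of "s \<otimes> N"] that by (auto simp: mem_left_ideal_iff mem_right_ideal_iff)
  obtain h where h: "h \<in> carrier R" "c = h \<otimes> N" using gens J_eq by (auto simp: mem_left_ideal_iff)
  obtain p where p: "p \<in> carrier R" "u = p \<otimes> N" using gens J_eq by (auto simp: mem_left_ideal_iff)
  have hz: "h \<noteq> \<zero>" using h cz Nc by auto
  \<comment> \<open>As \<open>c = hN\<close> is central, an element can be carried through
    \<open>h\<close> by carrying it through \<open>N\<close> and through \<open>c\<close> and then
    cancelling \<open>N\<close>. So \<open>h\<close> inherits twosidedness from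
    \<open>N\<close>.\<close>
  have h_right: "\<exists>s' \<in> carrier R. h \<otimes> s = s' \<otimes> h" if s: "s \<in> carrier R" for s
  proof -
    obtain s' where s': "s' \<in> carrier R" "s \<otimes> N = N \<otimes> s'" using left s by blast
    have "h \<otimes> s \<otimes> N = c \<otimes> s'" using s' s h Nc by (simp add: m_assoc)
    also have "\<dots> = s' \<otimes> h \<otimes> N" using comm s' h Nc by (simp add: m_assoc)
    finally show ?thesis using right_cancel[of N "h \<otimes> s" "s' \<otimes> h"] N Nc h s s' by auto
  qed
  have h_left: "\<exists>s' \<in> carrier R. s \<otimes> h = h \<otimes> s'" if s: "s \<in> carrier R" for s
  proof -
    obtain s' where s': "s' \<in> carrier R" "N \<otimes> s = s' \<otimes> N" using right s by blast
    have "s \<otimes> h \<otimes> N = c \<otimes> s" using comm s h Nc by (simp add: m_assoc)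
    also have "\<dots> = h \<otimes> s' \<otimes> N" using s' h Nc s by (simp add: m_assoc)
    finally show ?thesis using right_cancel[of N "s \<otimes> h" "h \<otimes> s'"] N Nc h s s' by auto
  qed
  have twoh: "twosided R h"
    using h h_left h_right
    by (fastforce simp: twosided_def set_eq_iff mem_left_ideal_iff mem_right_ideal_iff)
  \<comment> \<open>This is \<open>J^2 + Rc\<close>: \<open>RN\<close> is twosided, so its square is
    \<open>RNN\<close>, and \<open>hN = c\<close>.\<close>
  define M where "M = {(s \<otimes> N \<oplus> t \<otimes> h) \<otimes> N | s t. s \<in> carrier R \<and> t \<in> carrier R}"
  have memM: "(s \<otimes> N \<oplus> t \<otimes> h) \<otimes> N \<in> M" if "s \<in> carrier R" "t \<in> carrier R" for s t
    using that by (auto simp: M_def)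
  have "ideal M R"
  proof (rule idealI[OF ring_axioms])
    show "subgroup M (add_monoid R)"
    proof (rule add.subgroupI)
      show "M \<subseteq> carrier R" using Nc h by (auto simp: M_def)
      show "M \<noteq> {}" using memM by blast
      fix a assume "a \<in> M"
      then obtain s t where *: "s \<in> carrier R" "t \<in> carrier R" "a = (s \<otimes> N \<oplus> t \<otimes> h) \<otimes> N"
        by (auto simp: M_def)
      then have "\<ominus> a = (\<ominus> s \<otimes> N \<oplus> \<ominus> t \<otimes> h) \<otimes> N"
        using Nc h(1) by (simp add: l_distr l_minus minus_add)
      then show "\<ominus> a \<in> M"
        using memM[of "\<ominus> s" "\<ominus> t"] * by simp
      fix b assume "b \<in> M"
      then obtain s' t' where **: "s' \<in> carrier R" "t' \<in> carrier R" "b = (s' \<otimes> N \<oplus> t' \<otimes> h) \<otimes> N"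
        by (auto simp: M_def)
      with * have "a \<oplus> b = ((s \<oplus> s') \<otimes> N \<oplus> (t \<oplus> t') \<otimes> h) \<otimes> N"
        using Nc h(1) by (simp add: l_distr a_ac)
      then show "a \<oplus> b \<in> M" using memM * ** by simp
    qed
    fix a y assume "a \<in> M" and y: "y \<in> carrier R"
    then obtain s t where *: "s \<in> carrier R" "t \<in> carrier R" "a = (s \<otimes> N \<oplus> t \<otimes> h) \<otimes> N"
      by (auto simp: M_def)
    then have "y \<otimes> a = ((y \<otimes> s) \<otimes> N \<oplus> (y \<otimes> t) \<otimes> h) \<otimes> N"
      using Nc h y by (simp add: r_distr l_distr m_assoc)
    then show "y \<otimes> a \<in> M" using memM * y by simp
    obtain y' where y': "y' \<in> carrier R" "N \<otimes> y = y' \<otimes> N" using right y by blast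
    obtain y'' where y'': "y'' \<in> carrier R" "N \<otimes> y' = y'' \<otimes> N" using right y' by blast
    obtain z where z: "z \<in> carrier R" "h \<otimes> y' = z \<otimes> h" using h_right y' by blast
    have "a \<otimes> y = (s \<otimes> (N \<otimes> y') \<oplus> t \<otimes> (h \<otimes> y')) \<otimes> N"
      using * y y' Nc h by (simp add: l_distr m_assoc)
    also have "\<dots> = ((s \<otimes> y'') \<otimes> N \<oplus> (t \<otimes> z) \<otimes> h) \<otimes> N"
      unfolding y''(2) z(2) using * y''(1) z(1) Nc h(1) by (simp add: m_assoc)
    finally show "a \<otimes> y \<in> M" using memM[of "s \<otimes> y''" "t \<otimes> z"] * y''(1) z(1) by simp
  qed
  moreover have "c \<in> M" using memM[of \<zero> \<one>] h Nc by simp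
  moreover have "u \<in> M"
  proof -
    obtain v where v: "v \<in> carrier R" "u \<otimes> u \<ominus> u = v \<otimes> c" using u by (auto simp: mem_left_ideal_iff)
    obtain p' where p': "p' \<in> carrier R" "N \<otimes> p = p' \<otimes> N" using right p by blast
    have "u \<otimes> u = p \<otimes> (N \<otimes> p) \<otimes> N" using p Nc by (simp add: m_assoc)
    then have uu: "u \<otimes> u = p \<otimes> p' \<otimes> N \<otimes> N" unfolding p'(2) using p(1) p'(1) Nc by (simp add: m_assoc)
    \<comment> \<open>Idempotency modulo \<open>Rc\<close> enters here: \<open>u^2\<close> lies in
      \<open>J^2\<close> and the correction \<open>u^2 - u\<close> in \<open>Rc\<close>.\<close>
    have "u = u \<otimes> u \<ominus> (u \<otimes> u \<ominus> u)"
      using u by (simp add: minus_eq minus_add r_neg r_neg1 r_neg2 a_ac)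
    also have "\<dots> = p \<otimes> p' \<otimes> N \<otimes> N \<ominus> v \<otimes> (h \<otimes> N)"
      by (simp only: v(2)) (simp only: uu h(2))
    also have "\<dots> = ((p \<otimes> p') \<otimes> N \<oplus> (\<ominus> v) \<otimes> h) \<otimes> N"
      using p(1) p'(1) v(1) h(1) Nc by (simp add: minus_eq l_distr l_minus m_assoc)
    finally show ?thesis using memM[of "p \<otimes> p'" "\<ominus> v"] p(1) p'(1) v(1) by simp
  qed
  \<comment> \<open>With \<open>J\<close> inside \<open>M = (RN + Rh)N\<close>, the generator
    \<open>N\<close> is a multiple of itself by an element of \<open>RN + Rh\<close>; cancelling it
    puts \<open>1\<close> into \<open>RN + Rh\<close>.\<close>
  ultimately have "J \<subseteq> M" unfolding J_def using genideal_minimal[of M "{u, c}"] by auto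
  then obtain s t where st: "s \<in> carrier R" "t \<in> carrier R" "N = (s \<otimes> N \<oplus> t \<otimes> h) \<otimes> N"
    using N(1) by (auto simp: M_def)
  then have one: "\<one> = s \<otimes> N \<oplus> t \<otimes> h"
    using right_cancel[of N \<one> "s \<otimes> N \<oplus> t \<otimes> h"] N Nc h by auto
  have "N \<in> Units R \<or> h \<in> Units R"
  proof -
    have unit_factor: "b \<in> Units R" if "a \<in> carrier R" "b \<in> carrier R" "a \<otimes> b \<in> Units R" for a b
    proof -
      obtain w where "w \<in> carrier R" "w \<otimes> (a \<otimes> b) = \<one>"
        using Units_l_inv_ex[OF \<open>a \<otimes> b \<in> Units R\<close>] by blast
      then show ?thesis using unit_if_left_inverse[of "w \<otimes> a" b] that by (simp add: m_assoc)
    qed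
    have D_unit: "d \<in> Units R" if "d \<in> D - {\<zero>}" for d
      using D_inverse[of d] that D_mem_carrier unit_if_left_inverse by blast
    obtain d m \<alpha> where dm: "d \<in> D - {\<zero>}" "\<alpha> \<in> ring_center R" "N = d \<otimes> (x [^] (m::nat) \<otimes> \<alpha>)"
      using twosided_form[OF twoN N(2)] by blast
    obtain d' i \<beta> where di: "d' \<in> D - {\<zero>}" "\<beta> \<in> ring_center R" "h = d' \<otimes> (x [^] (i::nat) \<otimes> \<beta>)"
      using twosided_form[OF twoh hz] by blast
    have dc: "d \<in> carrier R" "d' \<in> carrier R" using dm di D_mem_carrier by auto
    have \<alpha>: "\<alpha> \<in> carrier R" "\<And>s. s \<in> carrier R \<Longrightarrow> \<alpha> \<otimes> s = s \<otimes> \<alpha>"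
      and \<beta>: "\<beta> \<in> carrier R" "\<And>s. s \<in> carrier R \<Longrightarrow> \<beta> \<otimes> s = s \<otimes> \<beta>"
      using dm di by (auto simp: ring_center_iff)
    \<comment> \<open>If one exponent vanishes, the corresponding factor of \<open>c\<close> is
      central up to a constant and irreducibility of \<open>c\<close> applies; if neither does,
      \<open>N\<close> and \<open>h\<close> both lie in \<open>Rx\<close>, which contradicts
      \<open>one\<close>.\<close>
    consider "m = 0" | "i = 0" | m' i' where "m = Suc m'" "i = Suc i'" by (cases m; cases i) auto
    then show ?thesis
    proof cases
      case 1
      then have N_eq: "N = d \<otimes> \<alpha>" using dm \<alpha> by simp
      then have "c = (h \<otimes> d) \<otimes> \<alpha>" using h dc \<alpha> by (simp add: m_assoc)
      then consider "\<alpha> \<in> Units R" | "h \<otimes> d \<in> Units R"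
        using central_irreducible_factor[OF irr dm(2) _ _ c] h dc by blast
      then show ?thesis
      proof cases
        case 1
        then show ?thesis using N_eq D_unit[OF dm(1)] by simp
      next
        case 2
        then have "(h \<otimes> d) \<otimes> inv d \<in> Units R" using D_unit[OF dm(1)] by simp
        then show ?thesis using h dc D_unit[OF dm(1)] by (simp add: m_assoc)
      qed
    next
      case 2
      then have h_eq: "h = d' \<otimes> \<beta>" using di \<beta> by simp
      then have "c = (d' \<otimes> N) \<otimes> \<beta>" using h(2) dc \<beta> Nc by (simp add: m_assoc)
      then consider "\<beta> \<in> Units R" | "d' \<otimes> N \<in> Units R"
        using central_irreducible_factor[OF irr di(2) _ _ c] Nc dc by blast
      then show ?thesis
        using h_eq D_unit[OF di(1)] unit_factor[of d' N] dc Nc by cases auto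
    next
      case 3
      have "N = (d \<otimes> \<alpha> \<otimes> x [^] m') \<otimes> x"
        unfolding dm(3) 3 using dc \<alpha> x_closed by (simp add: m_assoc)
      moreover have "h = (d' \<otimes> \<beta> \<otimes> x [^] i') \<otimes> x"
        unfolding di(3) 3 using dc \<beta> x_closed by (simp add: m_assoc)
      ultimately have "\<one> = (s \<otimes> (d \<otimes> \<alpha> \<otimes> x [^] m') \<oplus> t \<otimes> (d' \<otimes> \<beta> \<otimes> x [^] i')) \<otimes> x"
        using one st(1,2) dc \<alpha>(1) \<beta>(1) x_closed by (simp add: l_distr m_assoc)
      moreover have "s \<otimes> (d \<otimes> \<alpha> \<otimes> x [^] m') \<oplus> t \<otimes> (d' \<otimes> \<beta> \<otimes> x [^] i') \<in> carrier R"
        using st(1,2) dc \<alpha>(1) \<beta>(1) x_closed by simp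
      ultimately have "\<one> \<in> carrier R #> x" unfolding mem_left_ideal_iff by (rule bexI)
      then show ?thesis using one_not_in_left_ideal_x by blast
    qed
  qed
  \<comment> \<open>A unit \<open>h\<close> would give \<open>RN = Rc\<close>, so that
    \<open>u\<close> would lie in \<open>Rc\<close>.\<close>
  moreover have "h \<notin> Units R"
  proof
    assume hU: "h \<in> Units R"
    then have "N = inv h \<otimes> c" using h Nc by (simp flip: m_assoc)
    then have "u = (p \<otimes> inv h) \<otimes> c" using p cc hU by (simp add: m_assoc)
    then show False using u(3) p hU by (auto simp: mem_left_ideal_iff)
  qed
  ultimately have "N \<in> Units R" by blast
  then have "\<one> \<in> J" unfolding J_eq mem_left_ideal_iff using Units_l_inv Units_inv_closed by metis
  then show ?thesis unfolding J_def .
qed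

end

section \<open>Passage between \<open>R\<close> and its quotient by the bound\<close>

theorem proposition4p11:
  fixes R :: "('a, 'm) ring_scheme" and D K Kz :: "'a set" and \<sigma> \<delta> :: "'a \<Rightarrow> 'a"
    and x z f fs :: 'a and r :: nat and A :: "'a set ring" and a e :: "'a set"
  assumes "ore_extension R D \<sigma> \<delta> x"
    and "\<exists>b :: nat \<Rightarrow> 'a. left_basis R (ring_center R) {..<r} b"
    and "subfield K R"
    and "K \<subseteq> ring_center (R\<lparr>carrier := D\<rparr>)"
    and "\<sigma> ` K \<subseteq> K"
    and "\<forall>k \<in> K. \<delta> k = \<zero>\<^bsub>R\<^esub>"
    and "z \<in> carrier R" and "z \<notin> D"
    and "Kz = ring.simple_extension R K z"
    and "ring_center R = Kz"
    and "\<forall>g. twosided R g \<and> g \<noteq> \<zero>\<^bsub>R\<^esub> \<longrightarrow>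
           (\<exists>d \<in> D - {\<zero>\<^bsub>R\<^esub>}. \<exists>m :: nat. \<exists>\<alpha> \<in> Kz. g = d \<otimes>\<^bsub>R\<^esub> (x [^]\<^bsub>R\<^esub> m \<otimes>\<^bsub>R\<^esub> \<alpha>))"
    and "f \<in> carrier R"
    and "is_bound R f fs"
    and "fs \<in> Kz"
    and "ring_irreducible\<^bsub>R\<lparr>carrier := Kz\<rparr>\<^esub> fs"
    and "A = R Quot (carrier R #>\<^bsub>R\<^esub> fs)"
    and "a = (carrier R #>\<^bsub>R\<^esub> fs) +>\<^bsub>R\<^esub> f"
    and "e \<in> carrier A" and "e \<otimes>\<^bsub>A\<^esub> e = e"
    and "carrier A #>\<^bsub>A\<^esub> e = carrier A #>\<^bsub>A\<^esub> a"
  shows "nc_irreducible R f \<longleftrightarrow> skew_field (corner_ring A (\<one>\<^bsub>A\<^esub> \<ominus>\<^bsub>A\<^esub> e))"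
proof -
  interpret ore_extension R D \<sigma> \<delta> x by fact
  define I where "I = carrier R #>\<^bsub>R\<^esub> fs"
  have fsZ: "fs \<in> ring_center R" and fsc: "fs \<in> carrier R"
    using assms(10,14) by (auto simp: ring_center_iff)
  have irr: "ring_irreducible\<^bsub>R\<lparr>carrier := ring_center R\<rparr>\<^esub> fs" using assms(10,15) by simp
  have fsz: "fs \<noteq> \<zero>\<^bsub>R\<^esub>" using irr by (auto simp: ring_irreducible_def)
  interpret I: ideal I R
    unfolding I_def using fsZ by (intro ideal_if_twosided twosided_if_central)
  have A: "A = R Quot I" using assms(16) I_def by simp
  have carr: "carrier A = (+>\<^bsub>R\<^esub>) I ` carrier R"
    unfolding A FactRing_def A_RCOSETS_def' by auto
  have zeroA: "\<zero>\<^bsub>A\<^esub> = I" unfolding A FactRing_def by simp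
  interpret pi: ring_hom_ring R A "(+>\<^bsub>R\<^esub>) I" unfolding A by (rule I.rcos_ring_hom_ring)
  have fsI: "fs \<in> I" using fsc by (auto simp: I_def mem_left_ideal_iff intro!: bexI[of _ "\<one>\<^bsub>R\<^esub>"])
  have "I = annihilator_quot R f" using assms(13) by (simp add: is_bound_def I_def)
  \<comment> \<open>An element annihilating \<open>R/Rf\<close> kills in particular the class of
    \<open>1\<close>.\<close>
  then have IRf: "I \<subseteq> carrier R #>\<^bsub>R\<^esub> f"
    unfolding annihilator_quot_def by (metis (mono_tags, lifting) mem_Collect_eq one_closed r_one subsetI)
  \<comment> \<open>The nonzero bound lies in \<open>Rf\<close>.\<close>
  then have fz: "f \<noteq> \<zero>\<^bsub>R\<^esub>" using fsI fsz by (auto simp: mem_left_ideal_iff)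
  \<comment> \<open>\<open>Ae = Aa\<close> is the image of \<open>Rf\<close>, so maximality can be
    compared through \<open>left_maximal_Quot_iff\<close>.\<close>
  have "(carrier A #>\<^bsub>A\<^esub> e) = (+>\<^bsub>R\<^esub>) I ` (carrier R #>\<^bsub>R\<^esub> f)"
  proof (rule Set.set_eqI)
    fix Y
    have mult: "(I +>\<^bsub>R\<^esub> s) \<otimes>\<^bsub>A\<^esub> a = I +>\<^bsub>R\<^esub> (s \<otimes>\<^bsub>R\<^esub> f)" if "s \<in> carrier R" for s
      using that assms(12) by (simp add: assms(17) I_def[symmetric])
    have "Y \<in> carrier A #>\<^bsub>A\<^esub> e \<longleftrightarrow> (\<exists>s \<in> carrier R. Y = (I +>\<^bsub>R\<^esub> s) \<otimes>\<^bsub>A\<^esub> a)"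
      unfolding assms(20) mem_left_ideal_iff unfolding carr by blast
    also have "\<dots> \<longleftrightarrow> (\<exists>s \<in> carrier R. Y = I +>\<^bsub>R\<^esub> (s \<otimes>\<^bsub>R\<^esub> f))"
      by (intro bex_cong refl) (simp only: mult)
    also have "\<dots> \<longleftrightarrow> Y \<in> (+>\<^bsub>R\<^esub>) I ` (carrier R #>\<^bsub>R\<^esub> f)"
      unfolding image_iff Bex_def mem_left_ideal_iff by blast
    finally show "Y \<in> carrier A #>\<^bsub>A\<^esub> e \<longleftrightarrow> Y \<in> (+>\<^bsub>R\<^esub>) I ` (carrier R #>\<^bsub>R\<^esub> f)" .
  qed
  then have max: "left_maximal A (carrier A #>\<^bsub>A\<^esub> e) \<longleftrightarrow> nc_irreducible R f"
    unfolding A nc_irreducible_iff_left_maximal[OF assms(12) fz]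
    by (intro left_maximal_Quot_iff I.is_ideal left_ideal_add_subgroup assms(12) IRf)
  define u where "u = \<one>\<^bsub>A\<^esub> \<ominus>\<^bsub>A\<^esub> e"
  note u = pi.S.complement_idempotent[OF assms(18,19) u_def]
  \<comment> \<open>This establishes \<open>full\<close> for \<open>A\<close>; the skew field
    assumption enters through \<open>u \<noteq> 0\<close>.\<close>
  have "\<one>\<^bsub>A\<^esub> \<in> I'" if corner: "skew_field (corner_ring A u)" and I': "ideal I' A" "u \<in> I'" for I'
  proof -
    obtain v where v: "v \<in> carrier R" "u = I +>\<^bsub>R\<^esub> v" using u(1) unfolding carr by auto
    have "u \<noteq> \<zero>\<^bsub>A\<^esub>" using corner pi.S.skew_field_corner_iff[OF u(1,2)] by blast
    then have "v \<notin> I" using v a_rcos_zero[OF I.is_ideal] zeroA by auto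
    moreover have "v \<otimes>\<^bsub>R\<^esub> v \<ominus>\<^bsub>R\<^esub> v \<in> I"
    proof -
      have "I +>\<^bsub>R\<^esub> (v \<otimes>\<^bsub>R\<^esub> v) = I +>\<^bsub>R\<^esub> v" using v u(2) by simp
      then show ?thesis using quotient_eq_iff_same_a_r_cos[OF I.is_ideal, of "v \<otimes>\<^bsub>R\<^esub> v" v] v by simp
    qed
    ultimately have "\<one>\<^bsub>R\<^esub> \<in> Idl\<^bsub>R\<^esub> {v, fs}"
      using assms(10,11) irr fsZ v(1) unfolding I_def by (intro idempotent_generates) auto
    \<comment> \<open>The preimage of \<open>I'\<close> is an ideal of \<open>R\<close> containing
      the lift \<open>v\<close> of \<open>u\<close> and the bound, hence also
      \<open>1\<close>.\<close>
    moreover have "ideal {r \<in> carrier R. I +>\<^bsub>R\<^esub> r \<in> I'} R"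
      by (rule pi.ideal_vimage[OF I'(1)])
    then have "Idl\<^bsub>R\<^esub> {v, fs} \<subseteq> {r \<in> carrier R. I +>\<^bsub>R\<^esub> r \<in> I'}"
    proof (rule genideal_minimal)
      have "I +>\<^bsub>R\<^esub> fs = \<zero>\<^bsub>A\<^esub>" using fsI a_rcos_zero[OF I.is_ideal] zeroA by simp
      then have "I +>\<^bsub>R\<^esub> fs \<in> I'" using additive_subgroup.zero_closed[OF ideal.axioms(1)[OF I'(1)]] by simp
      then show "{v, fs} \<subseteq> {r \<in> carrier R. I +>\<^bsub>R\<^esub> r \<in> I'}" using v I'(2) fsc by auto
    qed
    ultimately have "I +>\<^bsub>R\<^esub> \<one>\<^bsub>R\<^esub> \<in> I'" by auto
    then show ?thesis by simp
  qed
  then have "skew_field (corner_ring A u) \<longleftrightarrow> left_maximal A (carrier A #>\<^bsub>A\<^esub> e)"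
    using pi.S.skew_field_corner_if_left_maximal[OF assms(18,19) u_def]
      pi.S.left_maximal_if_skew_field_corner[OF assms(18,19) u_def] by blast
  then show ?thesis using max unfolding u_def by blast
qed

end
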